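(* Let $d$ be a positive integer. For every $f\in C^{\infty}_{b,\mathrm{const}+}(\mathbb{R}^{d})$, $$I_{4/3}(f)+\frac{1}{3}I_{2/3}(f)^{2}\le \frac{2}{3}\left\|f^{-2/3}|\nabla f|^{2}\right\|_{1}.$$
   Context: $\gamma_{d}$ is the standard Gaussian measure on $\mathbb{R}^{d}$, i.e. $\frac{d\gamma_d}{dx}=(2\pi)^{-d/2}e^{-|x|^{2}/2}$, with $|\cdot|$ the Euclidean norm. For $p>0$ and measurable $f$ with $\int_{\mathbb{R}^d}|f|^p\,d\gamma_d<\infty$, $\|f\|_{p}:=\left\{\int_{\mathbb{R}^{d}}|f|^{p}\,d\gamma_{d}\right\}^{1/p}$ (also for $p<1$). $C^{\infty}_{b,\mathrm{const}+}(\mathbb{R}^{d})$ is the class of functions $f:\mathbb{R}^d\to\mathbb{R}$ that are the sum of a nonnegative function in $C^{\infty}_{b}(\mathbb{R}^{d})$ and a positive constant, where $C^{\infty}_{b}(\mathbb{R}^{d})$ is the class of real-valued bounded $C^{\infty}$-functions on $\mathbb{R}^{d}$ with bounded derivatives of all orders. For $p>0$ and $f\in C^{\infty}_{b,\mathrm{const}+}(\mathbb{R}^{d})$, $$I_{p}(f):=\frac{\|f\|_{p}^{p}-\|f\|_{1}^{p}}{p-1}\quad (p\neq 1),\qquad I_{1}(f):=\int_{\mathbb{R}^{d}}f\log\frac{f}{\|f\|_{1}}\,d\gamma_{d}.$$ *)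

theory Defs
  imports "HOL-Analysis.Analysis"
begin

definition gauss :: "'a::euclidean_space measure" where
  "gauss = density lborel
     (\<lambda>x. ennreal ((2 * pi) powr (- real DIM('a) / 2) * exp (- (norm x)\<^sup>2 / 2)))"

definition gauss_norm :: "real \<Rightarrow> ('a::euclidean_space \<Rightarrow> real) \<Rightarrow> real" where
  "gauss_norm p f = (\<integral>x. \<bar>f x\<bar> powr p \<partial>gauss) powr (1 / p)"

definition partial_deriv :: "'a::euclidean_space \<Rightarrow> ('a \<Rightarrow> real) \<Rightarrow> 'a \<Rightarrow> real" where
  "partial_deriv e f x = frechet_derivative f (at x) e"

fun iter_partial_deriv :: "'a::euclidean_space list \<Rightarrow> ('a \<Rightarrow> real) \<Rightarrow> 'a \<Rightarrow> real" where
  "iter_partial_deriv [] f = f"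
| "iter_partial_deriv (e # es) f = partial_deriv e (iter_partial_deriv es f)"

definition grad :: "('a::euclidean_space \<Rightarrow> real) \<Rightarrow> 'a \<Rightarrow> 'a" where
  "grad f x = (\<Sum>e\<in>Basis. partial_deriv e f x *\<^sub>R e)"

lemma GDERIV_grad:
  assumes "f differentiable (at x)"
  shows "GDERIV f x :> grad f x"
proof -
  let ?D = "frechet_derivative f (at x)"
  have D: "(f has_derivative ?D) (at x)"
    using assms by (simp add: frechet_derivative_works)
  then interpret linear ?D by (rule has_derivative_linear)
  have "?D h = h \<bullet> grad f x" for h
  proof -
    have "?D h = ?D (\<Sum>e\<in>Basis. (h \<bullet> e) *\<^sub>R e)"
      by (simp add: euclidean_representation)
    also have "\<dots> = h \<bullet> grad f x"
      by (simp add: sum scaleR grad_def partial_deriv_def inner_sum_right mult.commute)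
    finally show ?thesis .
  qed
  then have "?D = (\<lambda>h. h \<bullet> grad f x)" by (rule ext)
  with D show ?thesis by (simp add: gderiv_def)
qed

(* Total differentiability of every iterated partial derivative makes all of them
   continuous, so this is C-infinity in the usual sense; the empty list gives
   boundedness of f itself. *)
definition Cb_infinity :: "('a::euclidean_space \<Rightarrow> real) set" where
  "Cb_infinity = {f. \<forall>es. set es \<subseteq> Basis \<longrightarrow>
     (\<forall>x. iter_partial_deriv es f differentiable (at x)) \<and>
     bounded (range (iter_partial_deriv es f))}"

definition Cb_infinity_const_pos :: "('a::euclidean_space \<Rightarrow> real) set" where
  "Cb_infinity_const_pos =
     {f. \<exists>g c. g \<in> Cb_infinity \<and> (\<forall>x. 0 \<le> g x) \<and> 0 < c \<and> f = (\<lambda>x. g x + c)}"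

definition I_fun :: "real \<Rightarrow> ('a::euclidean_space \<Rightarrow> real) \<Rightarrow> real" where
  "I_fun p f =
     (if p = 1 then \<integral>x. f x * ln (f x / gauss_norm 1 f) \<partial>gauss
      else (gauss_norm p f powr p - gauss_norm 1 f powr p) / (p - 1))"

end

theory Submission
  imports Defs "HOL-Probability.Distributions" "HOL-Real_Asymp.Real_Asymp"
begin

text \<open>Write \<open>M\<close> for the Brownian martingale \<open>M t = E (f (W 1) | W t)\<close>, with gradient \<open>N t\<close>, and put
  \<open>m = \<integral>f\<close>, \<open>L = m powr (2/3) - \<integral>f powr (2/3)\<close>. The claim is equivalent to
  \<open>\<integral>f powr (4/3) - m powr (4/3) + 2 L (m powr (2/3) - \<integral>f powr (2/3)) - L\<^sup>2 \<le> 2/9 \<integral>f powr (-2/3) \<bar>\<nabla>f\<bar>\<^sup>2\<close>,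
  that is, to \<open>E (S 1 (M 1) (N 1)) \<le> S 0 (M 0) (N 0)\<close> for the function \<open>S = bellman L\<close> below, and this holds
  because \<open>S t (M t) (N t)\<close> is a supermartingale. The supermartingale property is checked in
  discrete time: one step of length \<open>h\<close> of the heat semigroup increases the expectation by at most
  \<open>O(h powr (3/2))\<close>, uniformly, so that the total error of \<open>n\<close> steps of length \<open>1/n\<close> vanishes in the limit.\<close>

subsection \<open>Moments of the Gaussian measure\<close>

text \<open>A squared expectation cannot be followed along a martingale, so the square is
  linearised: \<open>2 * L * s - L\<^sup>2 \<le> s\<^sup>2\<close>, with equality at
  \<open>s = L\<close>. The supermartingale property holds for every real \<open>L\<close>; only the
  conclusion inserts the particular value. The shape of \<open>S\<close> comes from Ito's formula.
  The power 4/3 of M gains drift (2/9) x^(-2/3) |v|^2, cancelled by the time derivative of the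
  gradient term, while the power 2/3 loses y = |v|^2 x^(-4/3) / 9. The terms with \<open>L\<close>
  thus contribute 2 L y - L^2, and a further -y^2 is needed for a perfect square. The convexity of
  the gradient term supplies -2 t y^2, and the time derivative of the quartic term supplies the
  rest, -(1 - 2 t) y^2. In discrete time only the powers of M are expanded. The terms that contain N
  are bounded from below by pointwise inequalities that are then averaged, so N is never
  differentiated and a Lipschitz bound on the gradient of f suffices.\<close>

lemma prod_normal_density:
  fixes x :: "'a::euclidean_space"
  assumes "\<sigma> > 0"
  shows "(\<Prod>b\<in>Basis. normal_density 0 \<sigma> (x \<bullet> b))
    = (2 * pi * \<sigma>\<^sup>2) powr (- real DIM('a) / 2) * exp (- (norm x)\<^sup>2 / (2 * \<sigma>\<^sup>2))"
proof -
  have "(\<Prod>b\<in>Basis. normal_density 0 \<sigma> (x \<bullet> b))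
     = (1 / sqrt (2 * pi * \<sigma>\<^sup>2)) ^ DIM('a) * exp (\<Sum>b\<in>Basis. - (x \<bullet> b)\<^sup>2 / (2 * \<sigma>\<^sup>2))"
    by (simp add: normal_density_def prod.distrib exp_sum prod_dividef power_one_over)
  also have "(\<Sum>b\<in>Basis. - (x \<bullet> b)\<^sup>2 / (2 * \<sigma>\<^sup>2)) = - (norm x)\<^sup>2 / (2 * \<sigma>\<^sup>2)"
    by (simp add: norm_eq_sqrt_inner euclidean_inner[of x x] power2_eq_square
        sum_divide_distrib sum_negf sum_nonneg)
  also have "(1 / sqrt (2 * pi * \<sigma>\<^sup>2)) ^ DIM('a) = (2 * pi * \<sigma>\<^sup>2) powr (- real DIM('a) / 2)"
  proof -
    have "1 / sqrt (2 * pi * \<sigma>\<^sup>2) = (2 * pi * \<sigma>\<^sup>2) powr (-1/2)"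
      using assms by (simp add: powr_minus_divide powr_half_sqrt[symmetric])
    moreover have "((2 * pi * \<sigma>\<^sup>2) powr (-1/2)) ^ DIM('a) = (2 * pi * \<sigma>\<^sup>2) powr (- real DIM('a) / 2)"
      using assms by (subst powr_realpow[symmetric]) (auto simp: powr_powr)
    ultimately show ?thesis by simp
  qed
  finally show ?thesis .
qed

text \<open>Two variances are used: \<open>\<sigma> = 1\<close> makes \<open>gauss\<close> a
  probability measure, and \<open>\<sigma> = sqrt 2\<close> integrates exp(-|x|^2 / 4).\<close>

lemma nn_integral_prod_normal_density:
  assumes "\<sigma> > 0"
  shows "(\<integral>\<^sup>+(x::'a::euclidean_space). (\<Prod>b\<in>Basis. normal_density 0 \<sigma> (x \<bullet> b)) \<partial>lborel) = 1"
proof -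
  interpret prob_space "density lborel (normal_density 0 \<sigma>)"
    using assms by (rule prob_space_normal_density)
  have "(\<integral>\<^sup>+x. ennreal (normal_density 0 \<sigma> x) \<partial>lborel) = 1"
    using emeasure_space_1 by (simp add: emeasure_density)
  then show ?thesis
    by (subst prod_ennreal[symmetric], simp, subst nn_integral_lborel_prod) simp_all
qed

lemma gauss_eq_prod:
  "(gauss :: 'a::euclidean_space measure)
   = density lborel (\<lambda>x. ennreal (\<Prod>b\<in>Basis. std_normal_density (x \<bullet> b)))"
  by (simp add: gauss_def prod_normal_density)

lemma sets_gauss [simp, measurable_cong]: "sets gauss = sets borel"
  and space_gauss [simp]: "space gauss = UNIV"
  by (simp_all add: gauss_def)

lemma nn_integral_gauss:
  fixes w :: "'a::euclidean_space \<Rightarrow> ennreal"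
  assumes "w \<in> borel_measurable borel"
  shows "(\<integral>\<^sup>+x. w x \<partial>gauss)
    = (2 * pi) powr (- real DIM('a) / 2) * (\<integral>\<^sup>+x. ennreal (exp (- (norm x)\<^sup>2 / 2)) * w x \<partial>lborel)"
  using assms unfolding gauss_def
  by (simp add: nn_integral_density nn_integral_cmult[symmetric] ennreal_mult' mult_ac)

interpretation gauss: prob_space "gauss :: 'a::euclidean_space measure"
proof
  show "emeasure gauss (space (gauss :: 'a measure)) = 1"
    using nn_integral_prod_normal_density[where 'a='a, of 1]
    by (simp add: gauss_eq_prod emeasure_density)
qed

lemma measure_gauss_UNIV [simp]: "measure (gauss :: 'a::euclidean_space measure) UNIV = 1"
  using gauss.prob_space by simp

interpretation gauss_pair: pair_prob_space "gauss :: 'a::euclidean_space measure" "gauss :: 'b::euclidean_space measure" ..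

text \<open>Times this weight, the standard density is a multiple of the centred Gaussian density of
  variance 2. As the weight dominates every polynomial in the norm, all moments follow from
  it.\<close>

lemma integrable_gauss_exp_norm_sq:
  "integrable gauss (\<lambda>z::'a::euclidean_space. exp ((norm z)\<^sup>2 / 4))"
proof (rule integrableI_bounded)
  define k :: real where "k = (4 * pi) powr (- real DIM('a) / 2)"
  have k: "k > 0" by (simp add: k_def)
  have "(\<integral>\<^sup>+z. ennreal (exp ((norm z)\<^sup>2 / 4)) \<partial>(gauss :: 'a measure))
      = (2 * pi) powr (- real DIM('a) / 2) * (\<integral>\<^sup>+(x::'a). ennreal (exp (- (norm x)\<^sup>2 / 4)) \<partial>lborel)"
    by (subst nn_integral_gauss) (simp_all add: ennreal_mult'[symmetric] exp_add[symmetric])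
  also have "(\<integral>\<^sup>+(x::'a). ennreal (exp (- (norm x)\<^sup>2 / 4)) \<partial>lborel)
     = (\<integral>\<^sup>+(x::'a). ennreal (1 / k) * ennreal (\<Prod>b\<in>Basis. normal_density 0 (sqrt 2) (x \<bullet> b)) \<partial>lborel)"
    using k by (intro nn_integral_cong)
      (simp add: prod_normal_density ennreal_mult'[symmetric] k_def)
  also have "\<dots> = ennreal (1 / k)"
    by (simp add: nn_integral_cmult nn_integral_prod_normal_density)
  finally show "(\<integral>\<^sup>+z. ennreal (norm (exp ((norm z)\<^sup>2 / 4))) \<partial>(gauss :: 'a measure)) < \<infinity>"
    by (simp add: ennreal_mult_less_top)
qed simp

lemma integrable_gauss_moment:
  "integrable gauss (\<lambda>z::'a::euclidean_space. (1 + norm z) ^ k)"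
proof -
  have "((\<lambda>r::real. (1 + r) ^ k / exp (r\<^sup>2 / 4)) \<longlongrightarrow> 0) at_top"
    by real_asymp
  then have "\<forall>\<^sub>F r::real in at_top. (1 + r) ^ k / exp (r\<^sup>2 / 4) < 1"
    by (rule order_tendstoD) simp
  then obtain N where N: "\<And>r::real. r \<ge> N \<Longrightarrow> (1 + r) ^ k / exp (r\<^sup>2 / 4) < 1"
    by (auto simp: eventually_at_top_linorder)
  have "(1 + norm z) ^ k \<le> (1 + \<bar>N\<bar>) ^ k + exp ((norm z)\<^sup>2 / 4)" for z :: 'a
  proof (cases "norm z \<ge> N")
    case True
    then have "(1 + norm z) ^ k < exp ((norm z)\<^sup>2 / 4)"
      using N[of "norm z"] by (simp add: divide_simps)
    then show ?thesis by (smt (verit) zero_le_power)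
  next
    case False
    then have "(1 + norm z) ^ k \<le> (1 + \<bar>N\<bar>) ^ k" by (intro power_mono) auto
    then show ?thesis by (smt (verit) exp_gt_zero)
  qed
  then show ?thesis
    by (intro Bochner_Integration.integrable_bound[OF Bochner_Integration.integrable_add[OF
          gauss.integrable_const[of "(1 + \<bar>N\<bar>) ^ k"] integrable_gauss_exp_norm_sq]])
      (auto intro!: AE_I2)
qed

lemma distr_gauss_uminus: "distr gauss borel uminus = (gauss :: 'a::euclidean_space measure)"
proof -
  have "lborel = distr lborel borel (uminus :: 'a \<Rightarrow> 'a)"
    using lborel_affine[of "-1" "0::'a"] by (simp add: density_1)
  then have "gauss = density (distr lborel borel (uminus :: 'a \<Rightarrow> 'a))
      (\<lambda>x. ennreal ((2 * pi) powr (- real DIM('a) / 2) * exp (- (norm x)\<^sup>2 / 2)))"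
    unfolding gauss_def by simp
  also have "\<dots> = distr gauss borel uminus"
    by (subst density_distr) (simp_all add: gauss_def)
  finally show ?thesis by simp
qed

text \<open>Completing the square turns the exponential into a translation by \<open>a\<close>,
  which Lebesgue measure does not see.\<close>

lemma nn_integral_gauss_exp_inner:
  "(\<integral>\<^sup>+z. ennreal (exp (a \<bullet> z)) \<partial>gauss) = ennreal (exp ((norm a)\<^sup>2 / 2))"
  for a :: "'a::euclidean_space"
proof -
  let ?k = "ennreal ((2 * pi) powr (- real DIM('a) / 2))"
  have e: "- (norm z)\<^sup>2 / 2 + a \<bullet> z = (norm a)\<^sup>2 / 2 - (norm (- a + z))\<^sup>2 / 2" for z
    by (simp add: power2_norm_eq_inner inner_simps inner_commute field_simps)
  have "(\<integral>\<^sup>+z. ennreal (exp (a \<bullet> z)) \<partial>gauss)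
      = ?k * (\<integral>\<^sup>+z. ennreal (exp (- (norm z)\<^sup>2 / 2)) * ennreal (exp (a \<bullet> z)) \<partial>lborel)"
    by (subst nn_integral_gauss) simp_all
  also have "\<dots> = ?k * (\<integral>\<^sup>+z. ennreal (exp ((norm a)\<^sup>2 / 2)) * ennreal (exp (- (norm (- a + z))\<^sup>2 / 2)) \<partial>lborel)"
    unfolding ennreal_mult'[OF exp_ge_zero, symmetric] exp_add[symmetric] e by simp
  also have "\<dots> = ennreal (exp ((norm a)\<^sup>2 / 2)) * (?k * (\<integral>\<^sup>+z. ennreal (exp (- (norm (- a + z))\<^sup>2 / 2)) \<partial>lborel))"
    by (simp add: nn_integral_cmult mult_ac)
  also have "(\<integral>\<^sup>+z. ennreal (exp (- (norm (- a + z))\<^sup>2 / 2)) \<partial>lborel)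
     = (\<integral>\<^sup>+z. ennreal (exp (- (norm z)\<^sup>2 / 2)) \<partial>distr lborel borel ((+) (- a)))"
    by (subst nn_integral_distr) simp_all
  also have "?k * \<dots> = (\<integral>\<^sup>+z. 1 \<partial>(gauss :: 'a measure))"
    unfolding lborel_distr_plus by (subst nn_integral_gauss) simp_all
  finally show ?thesis
    using gauss.emeasure_space_1[where 'a='a] by simp
qed

lemma
  fixes a :: "'a::euclidean_space"
  shows integrable_gauss_exp_inner: "integrable gauss (\<lambda>z. exp (a \<bullet> z))"
    and integral_gauss_exp_inner: "(\<integral>z. exp (a \<bullet> z) \<partial>gauss) = exp ((norm a)\<^sup>2 / 2)"
proof -
  have "has_bochner_integral gauss (\<lambda>z. exp (a \<bullet> z)) (exp ((norm a)\<^sup>2 / 2))"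
    by (rule has_bochner_integral_nn_integral) (simp_all add: nn_integral_gauss_exp_inner)
  then show "integrable gauss (\<lambda>z. exp (a \<bullet> z))"
    "(\<integral>z. exp (a \<bullet> z) \<partial>gauss) = exp ((norm a)\<^sup>2 / 2)"
    by (simp_all add: has_bochner_integral_iff)
qed

text \<open>The left side is the absolute value of exp(v) (1 - exp(-v))^2, and 1 - exp(-v) \<le> v.
  The bound dominates second difference quotients uniformly in their step.\<close>

lemma cosh_bound:
  fixes v :: real
  shows "\<bar>exp v + exp (- v) - 2\<bar> \<le> v\<^sup>2 * exp \<bar>v\<bar>"
proof -
  have *: "exp v + exp (- v) - 2 \<le> v\<^sup>2 * exp v" if "v \<ge> 0" for v :: real
  proof -
    have "exp v + exp (- v) - 2 = exp v * (1 - exp (- v))\<^sup>2"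
      by (simp add: power2_eq_square algebra_simps flip: exp_add)
    also have "(1 - exp (- v))\<^sup>2 \<le> v\<^sup>2"
      using that exp_ge_add_one_self[of "-v"] by (intro power_mono) auto
    finally show ?thesis by (simp add: mult.commute)
  qed
  have "exp v + exp (- v) - 2 \<ge> 0"
  proof -
    have "exp v + exp (- v) - 2 = exp v * (1 - exp (- v))\<^sup>2"
      by (simp add: power2_eq_square algebra_simps flip: exp_add)
    then show ?thesis by simp
  qed
  then show ?thesis
    using *[of "v"] *[of "-v"] by (cases "v \<ge> 0") auto
qed

lemma integrable_gauss_poly_bound:
  fixes w :: "'a::euclidean_space \<Rightarrow> 'b::{banach, second_countable_topology}"
  assumes "w \<in> borel_measurable borel" "\<And>z. norm (w z) \<le> C * (1 + norm z) ^ k"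
  shows "integrable gauss w"
proof (rule Bochner_Integration.integrable_bound)
  show "integrable gauss (\<lambda>z::'a. C * (1 + norm z) ^ k)"
    by (simp add: integrable_gauss_moment)
qed (use assms in \<open>auto intro!: AE_I2 intro: order_trans[OF _ abs_ge_self]\<close>)

lemma integral_gauss_odd:
  fixes w :: "'a::euclidean_space \<Rightarrow> real"
  assumes [measurable]: "w \<in> borel_measurable borel" and "\<And>z. w (- z) = - w z"
  shows "(\<integral>z. w z \<partial>gauss) = 0"
proof -
  have "(\<integral>z. w z \<partial>gauss) = (\<integral>z. w z \<partial>distr gauss borel uminus)"
    by (simp add: distr_gauss_uminus)
  also have "\<dots> = - (\<integral>z. w z \<partial>gauss)"
    by (simp add: integral_distr assms(2))
  finally show ?thesis by simp
qed

text \<open>The second moment is the limit of second difference quotients of the Laplace transform at \<open>0\<close>.\<close>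

lemma integral_gauss_inner_sq:
  fixes a :: "'a::euclidean_space"
  shows "(\<integral>z. (a \<bullet> z)\<^sup>2 \<partial>gauss) = (norm a)\<^sup>2"
proof (rule LIMSEQ_unique)
  let ?s = "\<lambda>n z. (real (Suc n))\<^sup>2 * (exp (a \<bullet> z / Suc n) + exp (- (a \<bullet> z / Suc n)) - 2)"
  show "(\<lambda>n. \<integral>z. ?s n z \<partial>gauss) \<longlonglongrightarrow> (\<integral>z. (a \<bullet> z)\<^sup>2 \<partial>gauss)"
  proof (rule integral_dominated_convergence)
    show "AE z in gauss. (\<lambda>n. ?s n z) \<longlonglongrightarrow> (a \<bullet> z)\<^sup>2"
    proof (rule AE_I2)
      fix z
      have "(\<lambda>n. (real (Suc n))\<^sup>2 * (exp (u / Suc n) + exp (- (u / Suc n)) - 2)) \<longlonglongrightarrow> u\<^sup>2" for u :: real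
        unfolding power2_eq_square[of u] by real_asymp
      then show "(\<lambda>n. ?s n z) \<longlonglongrightarrow> (a \<bullet> z)\<^sup>2" .
    qed
    show "AE z in gauss. norm (?s n z) \<le> 2 * (exp ((2 *\<^sub>R a) \<bullet> z) + exp ((- 2 *\<^sub>R a) \<bullet> z))" for n
    proof (rule AE_I2)
      fix z
      let ?u = "a \<bullet> z"
      have "norm (?s n z) \<le> (real (Suc n))\<^sup>2 * ((?u / Suc n)\<^sup>2 * exp \<bar>?u / Suc n\<bar>)"
        unfolding real_norm_def abs_mult by (intro mult_mono cosh_bound) auto
      also have "\<dots> = ?u\<^sup>2 * exp \<bar>?u / Suc n\<bar>" by (simp add: power_divide)
      also have "\<dots> \<le> ?u\<^sup>2 * exp \<bar>?u\<bar>"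
      proof -
        have "\<bar>?u\<bar> * 1 \<le> \<bar>?u\<bar> * Suc n" by (intro mult_left_mono) auto
        then show ?thesis by (intro mult_left_mono) (auto simp: divide_simps)
      qed
      \<comment> \<open>Trading the square for another exponential leaves a dominating function that
        is covered by the Laplace transform.\<close>
      also have "\<dots> \<le> (2 * exp \<bar>?u\<bar>) * exp \<bar>?u\<bar>"
        using exp_lower_Taylor_quadratic[of "\<bar>?u\<bar>"] by (intro mult_right_mono) auto
      also have "\<dots> = 2 * exp (2 * \<bar>?u\<bar>)" by (simp flip: exp_add)
      also have "\<dots> \<le> 2 * (exp (2 * ?u) + exp (- 2 * ?u))"
        by (cases "?u \<ge> 0") auto
      finally show "norm (?s n z) \<le> 2 * (exp ((2 *\<^sub>R a) \<bullet> z) + exp ((- 2 *\<^sub>R a) \<bullet> z))"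
        by simp
    qed
    show "integrable gauss (\<lambda>z. 2 * (exp ((2 *\<^sub>R a) \<bullet> z) + exp ((- 2 *\<^sub>R a) \<bullet> z)))"
      by (intro Bochner_Integration.integrable_add Bochner_Integration.integrable_mult_right
          integrable_gauss_exp_inner)
  qed simp_all
  have "(\<integral>z. ?s n z \<partial>gauss) = (real (Suc n))\<^sup>2 * (2 * exp ((norm a)\<^sup>2 / (2 * (real (Suc n))\<^sup>2)) - 2)" for n
  proof -
    have 1: "exp (a \<bullet> z / Suc n) = exp ((a /\<^sub>R Suc n) \<bullet> z)"
      "exp (- (a \<bullet> z / Suc n)) = exp ((- (a /\<^sub>R Suc n)) \<bullet> z)" for z
      by (simp_all add: divide_simps)
    have E: "has_bochner_integral gauss (\<lambda>z. exp (b \<bullet> z)) (exp ((norm b)\<^sup>2 / 2))" for b :: 'a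
      by (simp add: has_bochner_integral_iff integrable_gauss_exp_inner integral_gauss_exp_inner)
    have C: "has_bochner_integral gauss (\<lambda>z::'a. 2) (2::real)"
      by (simp add: has_bochner_integral_iff)
    have "(\<integral>z. ?s n z \<partial>gauss) = (real (Suc n))\<^sup>2
        * (exp ((norm (a /\<^sub>R Suc n))\<^sup>2 / 2) + exp ((norm (- (a /\<^sub>R Suc n)))\<^sup>2 / 2) - 2)"
      unfolding 1
      by (rule has_bochner_integral_integral_eq)
        (intro has_bochner_integral_mult_right has_bochner_integral_diff has_bochner_integral_add E C)
    moreover have "(norm (a /\<^sub>R Suc n))\<^sup>2 / 2 = (norm a)\<^sup>2 / (2 * (real (Suc n))\<^sup>2)"
      by (simp add: power_divide divide_simps)
    ultimately show ?thesis by simp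
  qed
  moreover have "(\<lambda>n. (real (Suc n))\<^sup>2 * (2 * exp (c / (2 * (real (Suc n))\<^sup>2)) - 2)) \<longlonglongrightarrow> c" for c :: real
    by real_asymp
  ultimately show "(\<lambda>n. \<integral>z. ?s n z \<partial>gauss) \<longlonglongrightarrow> (norm a)\<^sup>2"
    by simp
qed

subsection \<open>The heat semigroup\<close>

lemma nn_integral_lborel_affine:
  fixes w :: "'a::euclidean_space \<Rightarrow> ennreal"
  assumes [measurable]: "w \<in> borel_measurable borel" and "c > 0"
  shows "(\<integral>\<^sup>+z. w z \<partial>lborel) = ennreal (c ^ DIM('a)) * (\<integral>\<^sup>+z. w (t + c *\<^sub>R z) \<partial>lborel)"
proof -
  have "(\<integral>\<^sup>+z. w z \<partial>lborel)
      = (\<integral>\<^sup>+z. w z \<partial>density (distr lborel borel (\<lambda>x. t + c *\<^sub>R x)) (\<lambda>_. \<bar>c\<bar> ^ DIM('a)))"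
    using lborel_affine[of c t] assms(2) by simp
  also have "\<dots> = (\<integral>\<^sup>+z. ennreal (c ^ DIM('a)) * w (t + c *\<^sub>R z) \<partial>lborel)"
    using assms(2) by (simp add: nn_integral_density nn_integral_distr)
  finally show ?thesis
    by (simp add: nn_integral_cmult)
qed

text \<open>Invariance of the Gaussian under the Mehler kernel, obtained from reversibility: the
  joint density of y and x = s y + c z has exponent -(|x|^2 + |y|^2 - 2 s (x \<bullet> y)) / (2
  c^2), which is symmetric in x and y. After exchanging the order of integration, y integrates
  out.\<close>

lemma distr_gauss_rotate:
  assumes "c > 0" and s: "c\<^sup>2 + s\<^sup>2 = 1"
  shows "distr (gauss \<Otimes>\<^sub>M gauss) borel (\<lambda>(y, z). s *\<^sub>R y + c *\<^sub>R z) = (gauss :: 'a::euclidean_space measure)"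
proof (rule measure_eqI)
  fix A assume "A \<in> sets (distr (gauss \<Otimes>\<^sub>M gauss) borel (\<lambda>(y, z :: 'a). s *\<^sub>R y + c *\<^sub>R z))"
  then have A[measurable]: "A \<in> sets borel" by simp
  define k where "k = ennreal ((2 * pi) powr (- real DIM('a) / 2))"
  define d where "d = ennreal (c ^ DIM('a))"
  define E :: "'a \<Rightarrow> ennreal" where "E z = ennreal (exp (- (norm z)\<^sup>2 / 2))" for z
  have [measurable]: "E \<in> borel_measurable borel" unfolding E_def by measurable
  have G: "(\<integral>\<^sup>+z. w z \<partial>gauss) = k * (\<integral>\<^sup>+z. E z * w z \<partial>lborel)"
    if "w \<in> borel_measurable borel" for w :: "'a \<Rightarrow> ennreal"
    using that by (simp add: nn_integral_gauss k_def E_def)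
  have aff: "(\<integral>\<^sup>+z. w z \<partial>lborel) = d * (\<integral>\<^sup>+z. w (t + c *\<^sub>R z) \<partial>lborel)"
    if "w \<in> borel_measurable borel" for w :: "'a \<Rightarrow> ennreal" and t
    using nn_integral_lborel_affine[OF that assms(1)] by (simp add: d_def)
  have exch: "E y * E ((x - s *\<^sub>R y) /\<^sub>R c) = E x * E ((y - s *\<^sub>R x) /\<^sub>R c)" for x y
  proof -
    have e: "(norm ((u - s *\<^sub>R v) /\<^sub>R c))\<^sup>2 = (norm (u - s *\<^sub>R v))\<^sup>2 / c\<^sup>2" for u v :: 'a
      using assms(1) by (simp add: power_mult_distrib divide_inverse power_inverse mult.commute)
    have c: "c\<^sup>2 = 1 - s\<^sup>2" "c\<^sup>2 > 0" using assms by auto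
    have "(norm y)\<^sup>2 + (norm (x - s *\<^sub>R y))\<^sup>2 / c\<^sup>2 = (norm x)\<^sup>2 + (norm (y - s *\<^sub>R x))\<^sup>2 / c\<^sup>2"
    proof -
      have "(norm y)\<^sup>2 * c\<^sup>2 + (norm (x - s *\<^sub>R y))\<^sup>2 = (norm x)\<^sup>2 * c\<^sup>2 + (norm (y - s *\<^sub>R x))\<^sup>2"
        unfolding c(1) power2_norm_eq_inner
        by (simp add: inner_simps inner_commute power2_eq_square algebra_simps)
      then show ?thesis using c(2) by (simp add: field_simps)
    qed
    then show ?thesis
      unfolding E_def ennreal_mult'[OF exp_ge_zero, symmetric] exp_add[symmetric] e
      by (simp add: field_simps)
  qed
  have shift: "(\<integral>\<^sup>+z. E z * indicator A (s *\<^sub>R y + c *\<^sub>R z) \<partial>lborel) * d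
      = (\<integral>\<^sup>+x. E ((x - s *\<^sub>R y) /\<^sub>R c) * indicator A x \<partial>lborel)" for y
    using assms(1) by (subst (2) aff[of _ "s *\<^sub>R y"]) (simp_all add: mult.commute)
  have exch': "k * (E x * indicator A x * E ((y - s *\<^sub>R x) /\<^sub>R c))
      = E y * (k * (E ((x - s *\<^sub>R y) /\<^sub>R c) * indicator A x))" for x y
  proof -
    have "k * (E x * indicator A x * E ((y - s *\<^sub>R x) /\<^sub>R c))
        = k * indicator A x * (E x * E ((y - s *\<^sub>R x) /\<^sub>R c))"
      by (simp add: mult_ac)
    also have "\<dots> = E y * (k * (E ((x - s *\<^sub>R y) /\<^sub>R c) * indicator A x))"
      by (subst exch[symmetric]) (simp add: mult_ac)
    finally show ?thesis .
  qed
  define J where "J y = (\<integral>\<^sup>+z. E z * indicator A (s *\<^sub>R y + c *\<^sub>R z) \<partial>lborel)" for y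
  have [measurable]: "J \<in> borel_measurable borel" unfolding J_def by measurable
  have one: "k * (\<integral>\<^sup>+y. E ((y - s *\<^sub>R x) /\<^sub>R c) \<partial>lborel) = d" for x
  proof -
    have "(\<integral>\<^sup>+y. E ((y - s *\<^sub>R x) /\<^sub>R c) \<partial>lborel) = d * (\<integral>\<^sup>+y. E y \<partial>lborel)"
      using assms(1) by (subst aff[of _ "s *\<^sub>R x"]) simp_all
    moreover have "k * (\<integral>\<^sup>+y. E y \<partial>lborel) = 1"
      using G[of "\<lambda>_. 1"] gauss.emeasure_space_1[where 'a='a] by simp
    ultimately show ?thesis by (metis mult.left_commute mult.right_neutral)
  qed
  have "emeasure (distr (gauss \<Otimes>\<^sub>M gauss) borel (\<lambda>(y, z). s *\<^sub>R y + c *\<^sub>R z)) A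
      = (\<integral>\<^sup>+p. indicator A ((\<lambda>(y, z). s *\<^sub>R y + c *\<^sub>R z) p) \<partial>(gauss \<Otimes>\<^sub>M gauss))"
    by (subst nn_integral_indicator[symmetric], simp, subst nn_integral_distr) simp_all
  also have "\<dots> = (\<integral>\<^sup>+y. \<integral>\<^sup>+z. indicator A (s *\<^sub>R y + c *\<^sub>R z) \<partial>gauss \<partial>gauss)"
    by (subst gauss.nn_integral_fst[symmetric]) simp_all
  also have "\<dots> = k * (\<integral>\<^sup>+y. E y * (k * J y) \<partial>lborel)"
    unfolding J_def by (subst G, simp)+ simp
  \<comment> \<open>The Jacobian \<open>d\<close> of the substitution is multiplied in rather than
    divided out; being positive and finite, it cancels at the end.\<close>
  also have "\<dots> * d = k * (\<integral>\<^sup>+y. E y * (k * J y) * d \<partial>lborel)"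
    by (subst nn_integral_multc) (simp_all add: mult.assoc)
  also have "\<dots> = k * (\<integral>\<^sup>+y. E y * (k * (\<integral>\<^sup>+x. E ((x - s *\<^sub>R y) /\<^sub>R c) * indicator A x \<partial>lborel)) \<partial>lborel)"
    unfolding mult.assoc J_def shift ..
  also have "\<dots> = k * (\<integral>\<^sup>+y. \<integral>\<^sup>+x. k * (E x * indicator A x * E ((y - s *\<^sub>R x) /\<^sub>R c)) \<partial>lborel \<partial>lborel)"
    unfolding exch' by (simp add: nn_integral_cmult)
  also have "\<dots> = k * (\<integral>\<^sup>+x. \<integral>\<^sup>+y. k * (E x * indicator A x * E ((y - s *\<^sub>R x) /\<^sub>R c)) \<partial>lborel \<partial>lborel)"
    by (subst lborel_pair.Fubini') simp_all
  also have "\<dots> = k * (\<integral>\<^sup>+x. E x * indicator A x * (k * (\<integral>\<^sup>+y. E ((y - s *\<^sub>R x) /\<^sub>R c) \<partial>lborel)) \<partial>lborel)"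
    by (simp add: nn_integral_cmult mult_ac)
  also have "\<dots> = emeasure gauss A * d"
    unfolding one using G[of "indicator A"] by (subst nn_integral_multc) (simp_all add: mult.assoc)
  finally show "emeasure (distr (gauss \<Otimes>\<^sub>M gauss) borel (\<lambda>(y, z). s *\<^sub>R y + c *\<^sub>R z)) A = emeasure gauss A"
    using assms(1) by (auto simp: d_def ennreal_mult_cancel_left mult.commute[of _ "ennreal _"])
qed simp

text \<open>The mean of \<open>w\<close> at time \<open>r\<close> of a Brownian motion started in
  \<open>x\<close>. The values lie in a Banach space because the semigroup acts on gradients as well
  as on functions.\<close>

definition heat :: "real \<Rightarrow> ('a::euclidean_space \<Rightarrow> 'b::{banach, second_countable_topology}) \<Rightarrow> 'a \<Rightarrow> 'b"
  where "heat r w x = (\<integral>z. w (x + sqrt r *\<^sub>R z) \<partial>gauss)"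

lemma heat_0 [simp]: "heat 0 w = w"
  by (simp add: heat_def fun_eq_iff)

lemma borel_measurable_heat [measurable]:
  assumes [measurable]: "w \<in> borel_measurable borel"
  shows "heat r w \<in> borel_measurable borel"
  unfolding heat_def by measurable

lemma integrable_gauss_bounded:
  fixes w :: "'a::euclidean_space \<Rightarrow> 'b::{banach, second_countable_topology}"
  assumes "w \<in> borel_measurable borel" "\<And>x. norm (w x) \<le> K"
  shows "integrable gauss w"
  using assms by (intro gauss.integrable_const_bound[of _ K]) auto

lemma norm_heat_le:
  assumes [measurable]: "w \<in> borel_measurable borel" and "\<And>x. norm (w x) \<le> K"
  shows "norm (heat r w x) \<le> K"
proof -
  have "norm (heat r w x) \<le> (\<integral>z. norm (w (x + sqrt r *\<^sub>R z)) \<partial>gauss)"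
    unfolding heat_def by (rule integral_norm_bound)
  also have "\<dots> \<le> K"
    by (rule gauss.integral_le_const) (auto intro!: integrable_gauss_bounded[of _ K] AE_I2 simp: assms)
  finally show ?thesis .
qed

text \<open>For independent Gaussians y and z, sqrt a y + sqrt b z is sqrt (a + b) times a rotated
  combination of them, which is again standard Gaussian. The rotation needs a positive coefficient
  of z, so \<open>b = 0\<close> is treated apart.\<close>

lemma heat_heat:
  assumes [measurable]: "w \<in> borel_measurable borel" and bd: "\<And>x. norm (w x) \<le> K"
    and "a \<ge> 0" "b \<ge> 0"
  shows "heat a (heat b w) x = heat (a + b) w x"
proof (cases "b = 0")
  case False
  define c s where "c = sqrt (b / (a + b))" and "s = sqrt (a / (a + b))"
  have c: "c > 0" "c\<^sup>2 + s\<^sup>2 = 1" using False assms(3,4)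
    by (simp_all add: c_def s_def flip: add_divide_distrib)
  have sc: "sqrt (a + b) * s = sqrt a" "sqrt (a + b) * c = sqrt b"
    using False assms(3,4) by (simp_all add: c_def s_def flip: real_sqrt_mult)
  have "heat (a + b) w x = (\<integral>z. w (x + sqrt (a + b) *\<^sub>R z)
      \<partial>distr (gauss \<Otimes>\<^sub>M gauss) borel (\<lambda>(y, z). s *\<^sub>R y + c *\<^sub>R z))"
    unfolding heat_def by (simp add: distr_gauss_rotate[OF c])
  also have "\<dots> = (\<integral>p. (\<lambda>(y, z). w (x + sqrt a *\<^sub>R y + sqrt b *\<^sub>R z)) p \<partial>(gauss \<Otimes>\<^sub>M gauss))"
    by (subst integral_distr)
      (simp_all add: case_prod_unfold scaleR_add_right sc add.assoc)
  also have "\<dots> = heat a (heat b w) x"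
    unfolding heat_def
    by (subst gauss_pair.integral_fst'[symmetric])
      (auto intro!: gauss_pair.P.integrable_const_bound[of _ K] AE_I2 simp: bd)
  finally show ?thesis by simp
qed simp

subsection \<open>Second-order expansion along the heat semigroup\<close>

text \<open>This covers non-integrable \<open>f\<close> too, whose integral is 0 by convention, so
  each application only has to exhibit a dominating function.\<close>

lemma norm_integral_le:
  fixes f :: "'a \<Rightarrow> 'b::{banach, second_countable_topology}"
  assumes g: "integrable M g" and le: "\<And>x. norm (f x) \<le> g x"
  shows "norm (integral\<^sup>L M f) \<le> integral\<^sup>L M g"
proof -
  have "norm (integral\<^sup>L M f) \<le> (\<integral>x. norm (f x) \<partial>M)"
    by (rule integral_norm_bound)
  also have "\<dots> \<le> integral\<^sup>L M g"
    using g by (rule integral_mono') (auto intro: le order_trans[OF norm_ge_zero])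
  finally show ?thesis .
qed

text \<open>Fluctuations over a step will be bounded by a multiple of sqrt h (1 + |z|)^2, and their
  cubes need the sixth power. The lower powers are absorbed into the same moment.\<close>

definition moment6 :: "'a::euclidean_space itself \<Rightarrow> real" where
  "moment6 _ = (\<integral>(z::'a). (1 + norm z) ^ 6 \<partial>gauss)"

lemma moment6_ge_1: "moment6 TYPE('a::euclidean_space) \<ge> 1"
proof -
  have "(\<integral>(z::'a). 1 \<partial>gauss) \<le> moment6 TYPE('a)"
    unfolding moment6_def
    by (intro integral_mono integrable_gauss_moment) simp_all
  then show ?thesis by simp
qed

lemma norm_integral_gauss_le_moment6:
  fixes w :: "'a::euclidean_space \<Rightarrow> 'b::{banach, second_countable_topology}"
  assumes "\<And>z. norm (w z) \<le> K * (1 + norm z) ^ 6"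
  shows "norm (\<integral>z. w z \<partial>gauss) \<le> K * moment6 TYPE('a)"
proof -
  have "norm (\<integral>z. w z \<partial>gauss) \<le> (\<integral>(z::'a). K * (1 + norm z) ^ 6 \<partial>gauss)"
    by (rule norm_integral_le)
      (use assms in \<open>auto intro!: integrable_gauss_moment\<close>)
  then show ?thesis by (simp add: moment6_def)
qed

text \<open>\<open>F_taylor\<close> forces \<open>G\<close> to be the gradient of \<open>F\<close>,
  yet everything is phrased by increments: such bounds survive averaging over translates with the
  same \<open>c\<close> and \<open>B\<close>, without differentiating under an integral. This keeps
  the errors of all time steps uniform.\<close>

locale gradient_pair =
  fixes c B :: real and F :: "'a::euclidean_space \<Rightarrow> real" and G :: "'a \<Rightarrow> 'a"
  assumes F_measurable [measurable]: "F \<in> borel_measurable borel"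
    and G_measurable [measurable]: "G \<in> borel_measurable borel"
    and F_lower: "c \<le> F x" and F_upper: "F x \<le> B"
    and G_bound: "norm (G x) \<le> B"
    and G_lipschitz: "norm (G (x + w) - G x) \<le> B * norm w"
    and F_taylor: "\<bar>F (x + w) - F x - G x \<bullet> w\<bar> \<le> B * (norm w)\<^sup>2"
begin

lemma B_nonneg: "B \<ge> 0"
  using G_bound norm_ge_zero order_trans by blast

lemma abs_F_le: "norm (F x) \<le> \<bar>c\<bar> + \<bar>B\<bar>"
  using F_lower[of x] F_upper[of x] by auto

lemma integrable_F: "integrable gauss (\<lambda>z. F (x + a *\<^sub>R z))"
  by (rule integrable_gauss_bounded[OF _ abs_F_le]) measurable

lemma integrable_G: "integrable gauss (\<lambda>z. G (x + a *\<^sub>R z))"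
  by (rule integrable_gauss_bounded[OF _ G_bound]) measurable

lemma heat_F_lower: "c \<le> heat r F x"
  unfolding heat_def by (rule gauss.integral_ge_const) (auto intro!: integrable_F AE_I2 F_lower)

lemma heat_F_upper: "heat r F x \<le> B"
  unfolding heat_def by (rule gauss.integral_le_const) (auto intro!: integrable_F AE_I2 F_upper)

lemma gradient_pair_heat: "gradient_pair c B (heat r F) (heat r G)"
proof
  fix x w
  show "heat r F \<in> borel_measurable borel" "heat r G \<in> borel_measurable borel"
    by measurable
  show "c \<le> heat r F x" "heat r F x \<le> B" by (rule heat_F_lower heat_F_upper)+
  show "norm (heat r G x) \<le> B"
    by (rule norm_heat_le) (auto intro: G_bound)
  have "heat r G (x + w) - heat r G x
      = (\<integral>z. G ((x + sqrt r *\<^sub>R z) + w) - G (x + sqrt r *\<^sub>R z) \<partial>gauss)"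
    unfolding heat_def using integrable_G[of "x + w"] integrable_G[of x]
    by (simp add: add_ac)
  also have "norm \<dots> \<le> (\<integral>z. B * norm w \<partial>(gauss :: 'a measure))"
    by (rule norm_integral_le) (auto intro: G_lipschitz)
  finally show "norm (heat r G (x + w) - heat r G x) \<le> B * norm w" by simp
  have "heat r F (x + w) - heat r F x - heat r G x \<bullet> w
      = (\<integral>z. F ((x + sqrt r *\<^sub>R z) + w) - F (x + sqrt r *\<^sub>R z) - G (x + sqrt r *\<^sub>R z) \<bullet> w \<partial>gauss)"
    unfolding heat_def using integrable_F[of "x + w"] integrable_F[of x] integrable_G[of x]
    by (simp add: add_ac)
  also have "\<bar>\<dots>\<bar> \<le> (\<integral>z. B * (norm w)\<^sup>2 \<partial>(gauss :: 'a measure))"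
    unfolding real_norm_def[symmetric]
    by (rule norm_integral_le) (auto intro: F_taylor)
  finally show "\<bar>heat r F (x + w) - heat r F x - heat r G x \<bullet> w\<bar> \<le> B * (norm w)\<^sup>2" by simp
qed

text \<open>Ito's formula over one step, with explicit remainder. The expansion is centred at the
  mean \<open>heat h F x\<close> rather than at \<open>F x\<close>, so the first-order term
  integrates to zero exactly, and the result is expressed by the averaged value and gradient, which
  are the martingales one step earlier.\<close>

lemma heat_compose_taylor:
  fixes \<phi> \<phi>' \<phi>'' :: "real \<Rightarrow> real"
  assumes h: "0 \<le> h" "h \<le> 1" and T: "T \<ge> 0"
    and [measurable]: "\<phi> \<in> borel_measurable borel"
    and bd: "\<And>u. \<lbrakk>c \<le> u; u \<le> B\<rbrakk> \<Longrightarrow> \<bar>\<phi> u\<bar> \<le> K"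
    and bd2: "\<And>u. \<lbrakk>c \<le> u; u \<le> B\<rbrakk> \<Longrightarrow> \<bar>\<phi>'' u\<bar> \<le> T"
    and taylor: "\<And>u v. \<lbrakk>c \<le> u; u \<le> B; c \<le> v; v \<le> B\<rbrakk> \<Longrightarrow>
      \<bar>\<phi> u - \<phi> v - \<phi>' v * (u - v) - \<phi>'' v / 2 * (u - v)\<^sup>2\<bar> \<le> T * \<bar>u - v\<bar> ^ 3"
  defines "M \<equiv> moment6 TYPE('a)"
  shows "\<bar>heat h (\<lambda>y. \<phi> (F y)) x - \<phi> (heat h F x)
      - h / 2 * \<phi>'' (heat h F x) * (norm (heat h G x))\<^sup>2\<bar>
    \<le> T * (64 * B ^ 3 * M ^ 3 + 15 * B\<^sup>2 * M\<^sup>2) * M * (h * sqrt h)"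
proof -
  define X where "X z = F (x + sqrt h *\<^sub>R z)" for z
  define Fb where "Fb = heat h F x"
  define v where "v = heat h G x"
  define D where "D z = X z - Fb" for z
  \<comment> \<open>\<open>R\<close> is what remains of the fluctuation \<open>D\<close> after its
    linear part: the Taylor error, the shift of the mean and the change of gradient, each of order
    h, whereas \<open>D\<close> is of order sqrt h.\<close>
  define R where "R z = D z - sqrt h * (v \<bullet> z)" for z
  have [measurable]: "X \<in> borel_measurable borel" unfolding X_def by measurable
  have sq: "sqrt h * sqrt h = h" "h \<le> sqrt h" "sqrt h \<le> 1" "sqrt h \<ge> 0"
    using h by (simp_all add: real_le_rsqrt power2_eq_square mult_left_le)
  have M: "M \<ge> 1" unfolding M_def by (rule moment6_ge_1)
  note B = B_nonneg
  have BM: "B \<le> B * M" using B M mult_left_mono[of 1 M B] by simp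
  have BM0: "B * M \<ge> 0" using BM B by linarith
  have q: "1 \<le> (1 + norm z) ^ k" "(1 + norm z) ^ k \<le> (1 + norm z) ^ l" if "k \<le> l" for k l and z :: 'a
    using that by (simp_all add: power_increasing)
  have z2: "(norm z)\<^sup>2 \<le> (1 + norm z)\<^sup>2" "norm z \<le> (1 + norm z)\<^sup>2" for z :: 'a
    using norm_ge_zero[of z] by (simp_all add: power2_eq_square algebra_simps)
  have ft: "\<bar>X z - F x - sqrt h * (G x \<bullet> z)\<bar> \<le> B * h * (norm z)\<^sup>2" for z
    using F_taylor[of x "sqrt h *\<^sub>R z"] h by (simp add: X_def power_mult_distrib mult.assoc)
  have intX: "integrable gauss X" unfolding X_def by (rule integrable_F)
  have intin: "integrable gauss (\<lambda>z. a \<bullet> z)" for a :: 'a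
    by (rule integrable_gauss_poly_bound[where C = "norm a" and k = 1])
      (auto intro!: order_trans[OF Cauchy_Schwarz_ineq2] mult_left_mono)
  have intin2: "integrable gauss (\<lambda>z. (a \<bullet> z)\<^sup>2)" for a :: 'a
  proof (rule integrable_gauss_poly_bound[where C = "(norm a)\<^sup>2" and k = 2])
    show "norm ((a \<bullet> z)\<^sup>2) \<le> (norm a)\<^sup>2 * (1 + norm z)\<^sup>2" for z
      unfolding power_mult_distrib[symmetric] real_norm_def power_abs
      by (intro power_mono) (auto intro!: order_trans[OF Cauchy_Schwarz_ineq2] mult_left_mono)
  qed simp
  have in0: "(\<integral>z. a \<bullet> z \<partial>gauss) = 0" for a :: 'a
    by (rule integral_gauss_odd) simp_all
  have FbF: "\<bar>Fb - F x\<bar> \<le> B * M * h"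
  proof -
    have "Fb - F x = (\<integral>z. X z - F x - sqrt h * (G x \<bullet> z) \<partial>gauss)"
      using intX intin by (simp add: Fb_def heat_def X_def[symmetric] in0)
    moreover have "norm \<dots> \<le> (B * h) * M"
      unfolding M_def
    proof (rule norm_integral_gauss_le_moment6)
      fix z
      show "norm (X z - F x - sqrt h * (G x \<bullet> z)) \<le> B * h * (1 + norm z) ^ 6"
        using ft[of z] mult_left_mono[OF order_trans[OF z2(1)[of z] q(2)[of 2 6 z]], of "B * h"] B h
        by simp
    qed
    ultimately show ?thesis by (simp add: mult_ac)
  qed
  have vG: "norm (G x - v) \<le> B * M * sqrt h"
  proof -
    have "v - G x = (\<integral>z. G (x + sqrt h *\<^sub>R z) - G x \<partial>gauss)"
      using integrable_G[of x] by (simp add: v_def heat_def)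
    moreover have "norm \<dots> \<le> (B * sqrt h) * M"
      unfolding M_def
    proof (rule norm_integral_gauss_le_moment6)
      fix z
      show "norm (G (x + sqrt h *\<^sub>R z) - G x) \<le> B * sqrt h * (1 + norm z) ^ 6"
        using G_lipschitz[of x "sqrt h *\<^sub>R z"] sq
          mult_left_mono[OF order_trans[OF z2(2)[of z] q(2)[of 2 6 z]], of "B * sqrt h"] B h
        by (simp add: mult.assoc)
    qed
    ultimately show ?thesis by (simp add: mult_ac norm_minus_commute)
  qed
  have vB: "norm v \<le> B" unfolding v_def by (rule norm_heat_le) (auto intro: G_bound)
  have R: "\<bar>R z\<bar> \<le> 3 * (B * M) * h * (1 + norm z)\<^sup>2" for z
  proof -
    have "R z = (X z - F x - sqrt h * (G x \<bullet> z)) + (F x - Fb) + sqrt h * ((G x - v) \<bullet> z)"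
      by (simp add: R_def D_def algebra_simps)
    also have "\<bar>\<dots>\<bar> \<le> B * h * (norm z)\<^sup>2 + B * M * h + sqrt h * (B * M * sqrt h * norm z)"
    proof -
      have "\<bar>sqrt h * ((G x - v) \<bullet> z)\<bar> \<le> sqrt h * (B * M * sqrt h * norm z)"
        unfolding abs_mult using sq(4)
        by (intro mult_mono) (auto intro!: order_trans[OF Cauchy_Schwarz_ineq2] mult_right_mono vG)
      then show ?thesis using ft[of z] FbF by linarith
    qed
    also have "\<dots> = h * (B * (norm z)\<^sup>2 + B * M * 1 + B * M * norm z)"
      using sq(1) by (simp add: algebra_simps)
    also have "\<dots> \<le> h * (B * M * (1 + norm z)\<^sup>2 + B * M * (1 + norm z)\<^sup>2 + B * M * (1 + norm z)\<^sup>2)"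
      using h BM BM0 z2[of z] q(1)[of 2 2 z]
      by (intro mult_left_mono add_mono mult_mono) auto
    finally show ?thesis by (simp add: algebra_simps)
  qed
  have vz: "\<bar>sqrt h * (v \<bullet> z)\<bar> \<le> B * M * sqrt h * (1 + norm z)\<^sup>2" for z
  proof -
    have "\<bar>v \<bullet> z\<bar> \<le> (B * M) * (1 + norm z)\<^sup>2"
      using Cauchy_Schwarz_ineq2[of v z] mult_mono[OF order_trans[OF vB BM] z2(2)[of z]] BM0
      by (smt (verit) norm_ge_zero)
    then have "sqrt h * \<bar>v \<bullet> z\<bar> \<le> sqrt h * ((B * M) * (1 + norm z)\<^sup>2)"
      using sq(4) by (rule mult_left_mono)
    then show ?thesis using sq(4) by (simp add: abs_mult mult_ac)
  qed
  have R': "3 * (B * M) * h * (1 + norm z)\<^sup>2 \<le> 3 * (B * M) * sqrt h * (1 + norm z)\<^sup>2" for z :: 'a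
    using sq BM0 by (intro mult_right_mono mult_left_mono) auto
  have D: "\<bar>D z\<bar> \<le> 4 * (B * M) * sqrt h * (1 + norm z)\<^sup>2" for z
    using R[of z] R'[of z] vz[of z] by (simp add: R_def)
  have Dv: "\<bar>D z + sqrt h * (v \<bullet> z)\<bar> \<le> 5 * (B * M) * sqrt h * (1 + norm z)\<^sup>2" for z
    using D[of z] vz[of z] by linarith
  \<comment> \<open>A difference of squares: one factor is \<open>R\<close>, of order h, the other
    is of order sqrt h.\<close>
  have D2: "\<bar>(D z)\<^sup>2 - h * (v \<bullet> z)\<^sup>2\<bar> \<le> 15 * B\<^sup>2 * M\<^sup>2 * (h * sqrt h) * (1 + norm z) ^ 6" for z
  proof -
    have "(D z)\<^sup>2 - h * (v \<bullet> z)\<^sup>2 = R z * (D z + sqrt h * (v \<bullet> z))"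
      using sq(1) by (simp add: R_def power2_eq_square algebra_simps)
    also have "\<bar>\<dots>\<bar> \<le> (3 * (B * M) * h * (1 + norm z)\<^sup>2) * (5 * (B * M) * sqrt h * (1 + norm z)\<^sup>2)"
      unfolding abs_mult using h BM0 by (intro mult_mono R Dv) auto
    also have "\<dots> = 15 * B\<^sup>2 * M\<^sup>2 * (h * sqrt h) * (1 + norm z) ^ 4"
      by (simp add: power2_eq_square power4_eq_xxxx)
    also have "\<dots> \<le> 15 * B\<^sup>2 * M\<^sup>2 * (h * sqrt h) * (1 + norm z) ^ 6"
      using h by (intro mult_left_mono q) auto
    finally show ?thesis .
  qed
  have D3: "\<bar>D z\<bar> ^ 3 \<le> 64 * B ^ 3 * M ^ 3 * (h * sqrt h) * (1 + norm z) ^ 6" for z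
  proof -
    have "\<bar>D z\<bar> ^ 3 \<le> (4 * (B * M) * sqrt h * (1 + norm z)\<^sup>2) ^ 3"
      by (intro power_mono D) simp
    also have "\<dots> = 64 * B ^ 3 * M ^ 3 * (sqrt h * sqrt h * sqrt h) * ((1 + norm z)\<^sup>2) ^ 3"
    proof -
      have "(4 * (B * M) * s * u) ^ 3 = 64 * B ^ 3 * M ^ 3 * (s * s * s) * u ^ 3" for s u :: real
        by (simp add: power3_eq_cube)
      then show ?thesis .
    qed
    also have "((1 + norm z)\<^sup>2) ^ 3 = (1 + norm z) ^ 6" by (simp flip: power_mult)
    finally show ?thesis using sq(1) by simp
  qed
  have Fb: "c \<le> Fb" "Fb \<le> B" unfolding Fb_def by (rule heat_F_lower heat_F_upper)+
  have X: "c \<le> X z" "X z \<le> B" for z unfolding X_def by (rule F_lower F_upper)+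
  let ?w = "\<lambda>z. \<phi> (X z) - \<phi> Fb - \<phi>' Fb * D z - \<phi>'' Fb / 2 * (h * (v \<bullet> z)\<^sup>2)"
  have intphi: "integrable gauss (\<lambda>z. \<phi> (X z))"
    by (rule integrable_gauss_bounded[where K = K]) (auto intro: bd X)
  have "(\<integral>z. D z \<partial>gauss) = 0"
    using intX by (simp add: D_def) (simp add: Fb_def heat_def X_def[abs_def])
  moreover have "integrable gauss D" using intX by (simp add: D_def[abs_def])
  ultimately have "(\<integral>z. ?w z \<partial>gauss)
      = heat h (\<lambda>y. \<phi> (F y)) x - \<phi> Fb - \<phi>'' Fb / 2 * (h * (norm v)\<^sup>2)"
    using intphi intin2 by (simp add: heat_def X_def integral_gauss_inner_sq)
  moreover have "norm (\<integral>z. ?w z \<partial>gauss) \<le> (T * (64 * B ^ 3 * M ^ 3 + 15 * B\<^sup>2 * M\<^sup>2) * (h * sqrt h)) * M"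
    unfolding M_def
  proof (rule norm_integral_gauss_le_moment6, fold M_def)
    fix z :: 'a
    let ?H = "(h * sqrt h) * (1 + norm z) ^ 6"
    have "?w z = (\<phi> (X z) - \<phi> Fb - \<phi>' Fb * (X z - Fb) - \<phi>'' Fb / 2 * (X z - Fb)\<^sup>2)
        + \<phi>'' Fb / 2 * ((D z)\<^sup>2 - h * (v \<bullet> z)\<^sup>2)"
      by (simp add: D_def algebra_simps)
    also have "norm \<dots> \<le> T * \<bar>D z\<bar> ^ 3 + T * \<bar>(D z)\<^sup>2 - h * (v \<bullet> z)\<^sup>2\<bar>"
    proof -
      have "\<bar>\<phi>'' Fb / 2 * ((D z)\<^sup>2 - h * (v \<bullet> z)\<^sup>2)\<bar> \<le> T * \<bar>(D z)\<^sup>2 - h * (v \<bullet> z)\<^sup>2\<bar>"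
        unfolding abs_mult using bd2[OF Fb] by (intro mult_right_mono) auto
      then show ?thesis
        using taylor[OF X(1)[of z] X(2)[of z] Fb] unfolding D_def[symmetric] real_norm_def by linarith
    qed
    also have "\<dots> \<le> T * (64 * B ^ 3 * M ^ 3 * (h * sqrt h) * (1 + norm z) ^ 6)
        + T * (15 * B\<^sup>2 * M\<^sup>2 * (h * sqrt h) * (1 + norm z) ^ 6)"
      using T by (intro add_mono mult_left_mono D2 D3)
    finally show "norm (?w z) \<le> T * (64 * B ^ 3 * M ^ 3 + 15 * B\<^sup>2 * M\<^sup>2) * (h * sqrt h) * (1 + norm z) ^ 6"
      by (simp add: algebra_simps)
  qed
  ultimately show ?thesis by (simp add: Fb_def v_def mult_ac)
qed

end

subsection \<open>The supermartingale\<close>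

text \<open>Lagrange remainder: as \<open>p \<le> 3\<close>, the power in the third derivative
  decreases, so its value at \<open>c\<close> bounds it on the whole range.\<close>

lemma powr_taylor:
  fixes c u v p :: real
  assumes c: "0 < c" "c \<le> u" "c \<le> v" and p: "p \<le> 3"
  shows "\<bar>u powr p - v powr p - p * v powr (p - 1) * (u - v) - p * (p - 1) * v powr (p - 2) / 2 * (u - v)\<^sup>2\<bar>
    \<le> \<bar>p * (p - 1) * (p - 2)\<bar> * c powr (p - 3) * \<bar>u - v\<bar> ^ 3"
proof (cases "u = v")
  case False
  define diff where "diff m t = (\<Prod>i<m. p - real i) * t powr (p - real m)" for m t
  have "\<exists>t. (if u < v then u < t \<and> t < v else v < t \<and> t < u) \<and>
      u powr p = (\<Sum>m<3. (diff m v / fact m) * (u - v) ^ m) + (diff 3 t / fact 3) * (u - v) ^ 3"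
  proof (rule Taylor[where a = c and b = "max u v"])
    show "\<forall>(m::nat) t. m < 3 \<and> c \<le> t \<and> t \<le> max u v \<longrightarrow> (diff m has_real_derivative diff (Suc m) t) (at t)"
    proof (intro allI impI)
      fix m :: nat and t assume "m < 3 \<and> c \<le> t \<and> t \<le> max u v"
      then have "t > 0" using c by linarith
      then show "(diff m has_real_derivative diff (Suc m) t) (at t)"
        using DERIV_cmult[OF has_real_derivative_powr[of t "p - real m"], of "\<Prod>i<m. p - real i"]
        unfolding diff_def[abs_def] by (simp add: mult.assoc diff_diff_eq add.commute)
    qed
  qed (use False c in \<open>auto simp: diff_def\<close>)
  then obtain t where t: "if u < v then u < t \<and> t < v else v < t \<and> t < u"
    and eq: "u powr p = (\<Sum>m<3. (diff m v / fact m) * (u - v) ^ m) + (diff 3 t / fact 3) * (u - v) ^ 3"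
    by blast
  have "t \<ge> c" using t c by (auto split: if_splits)
  then have tp: "t powr (p - 3) \<le> c powr (p - 3)"
    using c p by (intro powr_mono2') auto
  have "\<bar>diff 3 t / fact 3\<bar> = \<bar>p * (p - 1) * (p - 2)\<bar> * t powr (p - 3) / 6"
    by (simp add: diff_def eval_nat_numeral lessThan_Suc abs_mult fact_Suc mult_ac)
  also have "\<dots> \<le> \<bar>p * (p - 1) * (p - 2)\<bar> * c powr (p - 3)"
  proof -
    have "\<bar>p * (p - 1) * (p - 2)\<bar> * t powr (p - 3) \<ge> 0" by simp
    with mult_left_mono[OF tp, of "\<bar>p * (p - 1) * (p - 2)\<bar>"] show ?thesis by linarith
  qed
  finally have "\<bar>(diff 3 t / fact 3) * (u - v) ^ 3\<bar>
      \<le> \<bar>p * (p - 1) * (p - 2)\<bar> * c powr (p - 3) * \<bar>u - v\<bar> ^ 3"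
    unfolding abs_mult power_abs by (intro mult_right_mono) auto
  moreover have "u powr p - v powr p - p * v powr (p - 1) * (u - v) - p * (p - 1) * v powr (p - 2) / 2 * (u - v)\<^sup>2
      = (diff 3 t / fact 3) * (u - v) ^ 3"
    unfolding eq by (simp add: diff_def eval_nat_numeral lessThan_Suc algebra_simps)
  ultimately show ?thesis by simp
qed simp

text \<open>Minimising over \<open>v\<close> exactly, instead of using only the tangent plane, keeps the second-order
  gain in \<open>x\<close> that joint convexity would lose.\<close>

lemma norm_sq_over_powr_tangent:
  fixes v w :: "'a::real_inner"
  assumes "x > 0" "y > 0"
  shows "2 * y powr (-2/3) * (w \<bullet> v) - (norm w)\<^sup>2 * y powr (-4/3) * x powr (2/3)
    \<le> x powr (-2/3) * (norm v)\<^sup>2"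
proof -
  \<comment> \<open>The coefficients are chosen so that \<open>?a * ?b\<close> is free of
    \<open>x\<close>; the cross term of the square is then linear in \<open>v\<close> alone and can
    be averaged.\<close>
  let ?a = "x powr (-1/3)" and ?b = "x powr (1/3) * y powr (-2/3)"
  have ab: "?a\<^sup>2 = x powr (-2/3)" "?b\<^sup>2 = y powr (-4/3) * x powr (2/3)" "?a * ?b = y powr (-2/3)"
    using assms by (simp_all add: power_mult_distrib powr_power mult.assoc[symmetric] powr_add[symmetric])
  have "0 \<le> (norm (?a *\<^sub>R v - ?b *\<^sub>R w))\<^sup>2" by simp
  also have "\<dots> = ?a\<^sup>2 * (norm v)\<^sup>2 - 2 * (?a * ?b) * (w \<bullet> v) + ?b\<^sup>2 * (norm w)\<^sup>2"
    unfolding power2_norm_eq_inner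
    by (simp add: inner_simps inner_commute power2_eq_square algebra_simps)
  finally show ?thesis unfolding ab by (simp add: mult_ac)
qed

text \<open>AM-GM for \<open>r\<^sup>4 x powr (-8/3)\<close>, \<open>x\<close>, \<open>1\<close> with weights \<open>1/4\<close>, \<open>2/3\<close>, \<open>1/12\<close>.\<close>

lemma quartic_tangent_aux:
  fixes r x :: real
  assumes "r > 0" "x > 0"
  shows "4 * r - 8/3 * x - 1/3 \<le> r ^ 4 * x powr (-8/3)"
proof -
  have p: "r ^ 3 * x powr (-8/3) > 0" using assms by simp
  have "ln (r ^ 3 * x powr (-8/3)) = 3 * ln r - 8/3 * ln x"
    using assms by (simp add: ln_mult ln_powr ln_realpow)
  moreover have "ln (x / r) = ln x - ln r" "ln (1 / r) = - ln r"
    using assms by (simp_all add: ln_div)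
  ultimately have "r ^ 3 * x powr (-8/3) / 4 + 2/3 * (x / r) + 1/12 * (1 / r) \<ge> 1"
    using ln_le_minus_one[OF p] ln_le_minus_one[of "x / r"] ln_le_minus_one[of "1 / r"] assms
    by simp
  then have "r * 1 \<le> r * (r ^ 3 * x powr (-8/3) / 4 + 2/3 * (x / r) + 1/12 * (1 / r))"
    using assms by (intro mult_left_mono) auto
  also have "\<dots> = r ^ 4 * x powr (-8/3) / 4 + 2/3 * x + 1/12"
    using assms by (simp add: field_simps eval_nat_numeral)
  finally show ?thesis by linarith
qed

text \<open>The left side is the tangent plane at \<open>(w, y)\<close> of a function that is
  jointly convex because 4 \<ge> 1 + 8/3. Scaling by its value there leaves the ratio x / y and the
  component r of v along w; by Cauchy-Schwarz the scalar AM-GM bound suffices when r > 0, and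
  otherwise the scaled plane is negative.\<close>

lemma norm_quartic_over_powr_tangent:
  fixes v w :: "'a::real_inner"
  assumes "x > 0" "y > 0"
  shows "(norm w) ^ 4 * y powr (-8/3) + 4 * (norm w)\<^sup>2 * y powr (-8/3) * (w \<bullet> v - (norm w)\<^sup>2)
      - 8/3 * (norm w) ^ 4 * y powr (-8/3) / y * (x - y)
    \<le> (norm v) ^ 4 * x powr (-8/3)"
proof (cases "w = 0")
  case False
  define r where "r = w \<bullet> v / (norm w)\<^sup>2"
  define z where "z = x / y"
  have z: "z > 0" "x = z * y" using assms by (simp_all add: z_def)
  have wv: "w \<bullet> v = r * (norm w)\<^sup>2" using False by (simp add: r_def)
  have "4 * r - 8/3 * z - 1/3 \<le> (norm v / norm w) ^ 4 * z powr (-8/3)"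
  proof (cases "r > 0")
    case True
    have "r * norm w \<le> norm v"
    proof -
      have "(r * norm w) * norm w \<le> norm v * norm w"
        using Cauchy_Schwarz_ineq2[of w v] wv by (simp add: power2_eq_square mult_ac)
      then show ?thesis using False by simp
    qed
    then have "r \<le> norm v / norm w" using False by (simp add: field_simps)
    then have "r ^ 4 * z powr (-8/3) \<le> (norm v / norm w) ^ 4 * z powr (-8/3)"
      using True by (intro mult_right_mono power_mono) auto
    with quartic_tangent_aux[OF True z(1)] show ?thesis by linarith
  next
    case False
    then have "4 * r - 8/3 * z - 1/3 \<le> 0" using z by linarith
    also have "0 \<le> (norm v / norm w) ^ 4 * z powr (-8/3)" by simp
    finally show ?thesis .
  qed
  then have "((norm w) ^ 4 * y powr (-8/3)) * (4 * r - 8/3 * z - 1/3)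
      \<le> ((norm w) ^ 4 * y powr (-8/3)) * ((norm v / norm w) ^ 4 * z powr (-8/3))"
    by (intro mult_left_mono) auto
  also have "\<dots> = (norm v) ^ 4 * x powr (-8/3)"
    using False assms z by (simp add: power_divide powr_mult)
  finally have *: "((norm w) ^ 4 * y powr (-8/3)) * (4 * r - 8/3 * z - 1/3) \<le> (norm v) ^ 4 * x powr (-8/3)" .
  have "8/3 * (norm w) ^ 4 * y powr (-8/3) / y * (x - y) = 8/3 * ((norm w) ^ 4 * y powr (-8/3)) * (z - 1)"
    using assms by (simp add: z field_simps)
  moreover have "4 * (norm w)\<^sup>2 * y powr (-8/3) * (w \<bullet> v - (norm w)\<^sup>2)
      = 4 * ((norm w) ^ 4 * y powr (-8/3)) * (r - 1)"
    by (simp add: wv power2_eq_square power4_eq_xxxx algebra_simps)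
  ultimately show ?thesis
    using * by (simp add: right_diff_distrib)
qed simp

text \<open>Along the martingale \<open>(heat (1 - t) f, heat (1 - t) (\<nabla>f))\<close> evaluated at Brownian motion this
  function of time, value and gradient is a supermartingale: with \<open>y = \<bar>v\<bar>\<^sup>2 x powr (-4/3) / 9\<close> its drift
  is at most \<open>- (L - y)\<^sup>2\<close>. The quartic term is convex in \<open>(x, v)\<close> and has the weight \<open>t (1 - t)\<close> that
  turns the factor \<open>2 t\<close> in front of \<open>y\<^sup>2\<close> into the constant \<open>1\<close>.\<close>

definition bellman :: "real \<Rightarrow> real \<Rightarrow> real \<Rightarrow> 'a::real_normed_vector \<Rightarrow> real" where
  "bellman L t x v = x powr (4/3) - 2 * L * x powr (2/3) - 2/9 * t * (x powr (-2/3) * (norm v)\<^sup>2)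
     - t * (1 - t) / 81 * ((norm v) ^ 4 * x powr (-8/3)) - L\<^sup>2 * t"

lemma measurable_bellman [measurable]:
  fixes F :: "'a \<Rightarrow> real" and G :: "'a \<Rightarrow> 'b::euclidean_space"
  assumes [measurable]: "F \<in> borel_measurable M" "G \<in> borel_measurable M"
  shows "(\<lambda>y. bellman L t (F y) (G y)) \<in> borel_measurable M"
  unfolding bellman_def by measurable

section \<open>The drift inequality over one time step\<close>

text \<open>The drift computation stripped of analysis: \<open>a1\<close>, \<open>a2\<close>,
  \<open>K\<close>, \<open>Y\<close> stand for averages over the step of the four nonconstant terms,
  and \<open>b1\<close>, \<open>b2\<close>, \<open>k\<close>, \<open>81 * y\<^sup>2\<close> for
  their values at the averaged point. The gap between the two sides splits into five nonnegative
  groups.\<close>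

lemma bellman_step_aux:
  fixes a1 a2 b1 b2 k K y Y :: real
  assumes A: "a1 - b1 - 2/9 * h * k \<le> C1 * H"
    and D: "\<bar>b2 - a2 - h * y\<bar> \<le> C2 * H"
    and K: "k + 9 * y * (b2 - a2) \<le> K" and Y: "81 * y\<^sup>2 \<le> Y"
    and y: "0 \<le> y" "y \<le> m" and th: "0 \<le> t" "0 \<le> h" "t + h \<le> 1"
  shows "a1 - 2 * L * a2 - 2/9 * (t + h) * K - (t + h) * (1 - (t + h)) / 81 * Y - L\<^sup>2 * (t + h)
    \<le> b1 - 2 * L * b2 - 2/9 * t * k - t * (1 - t) / 81 * (81 * y\<^sup>2) - L\<^sup>2 * t
      + (C1 + 2 * (\<bar>L\<bar> + m) * C2) * H"
proof -
  define e where "e = b2 - a2 - h * y"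
  have a2: "a2 = b2 - h * y - e" by (simp add: e_def)
  have 1: "0 \<le> 2/9 * (t + h) * (K - (k + 9 * y * (h * y + e)))"
    using K th by (intro mult_nonneg_nonneg) (auto simp: a2)
  have 2: "0 \<le> (t + h) * (1 - (t + h)) / 81 * (Y - 81 * y\<^sup>2)"
    using Y th by (intro mult_nonneg_nonneg) auto
  have 3: "0 \<le> 2 * (\<bar>L\<bar> + m) * (C2 * H) - 2 * (L - (t + h) * y) * e"
  proof -
    have "(t + h) * y \<le> 1 * m" using th y by (intro mult_mono) auto
    moreover have "0 \<le> (t + h) * y" using th y by simp
    moreover have "\<bar>2 * (L - r)\<bar> \<le> 2 * (\<bar>L\<bar> + m)" if "r \<le> 1 * m" "0 \<le> r" for r
      using that abs_ge_self[of L] abs_ge_minus_self[of L]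
      by (intro abs_leI) (simp_all add: algebra_simps)
    ultimately have "\<bar>2 * (L - (t + h) * y)\<bar> \<le> 2 * (\<bar>L\<bar> + m)" by blast
    then have "\<bar>2 * (L - (t + h) * y)\<bar> * \<bar>e\<bar> \<le> 2 * (\<bar>L\<bar> + m) * (C2 * H)"
      using D y unfolding e_def by (intro mult_mono) auto
    moreover have "2 * (L - (t + h) * y) * e \<le> \<bar>2 * (L - (t + h) * y)\<bar> * \<bar>e\<bar>"
      unfolding abs_mult[symmetric] by (rule abs_ge_self)
    ultimately show ?thesis by linarith
  qed
  \<comment> \<open>The discrete form of the drift -(L - y)^2. The surplus h^2 y^2 has the
    favourable sign: the gradient term yields 2 h^2 y^2, of which the change of the quartic weight
    consumes only half.\<close>
  have 4: "0 \<le> h * (L - y)\<^sup>2 + h\<^sup>2 * y\<^sup>2" using th by simp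
  have "(b1 - 2 * L * b2 - 2/9 * t * k - t * (1 - t) / 81 * (81 * y\<^sup>2) - L\<^sup>2 * t
        + (C1 + 2 * (\<bar>L\<bar> + m) * C2) * H)
      - (a1 - 2 * L * a2 - 2/9 * (t + h) * K - (t + h) * (1 - (t + h)) / 81 * Y - L\<^sup>2 * (t + h))
    = (C1 * H - (a1 - b1 - 2/9 * h * k))
      + 2/9 * (t + h) * (K - (k + 9 * y * (h * y + e)))
      + (t + h) * (1 - (t + h)) / 81 * (Y - 81 * y\<^sup>2)
      + (2 * (\<bar>L\<bar> + m) * (C2 * H) - 2 * (L - (t + h) * y) * e)
      + (h * (L - y)\<^sup>2 + h\<^sup>2 * y\<^sup>2)"
    unfolding a2 by (simp add: field_simps power2_eq_square)
  with A 1 2 3 4 show ?thesis by linarith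
qed

text \<open>What matters is the order of quantifiers: \<open>C\<close> is fixed before the pair, the
  step and the point, so that one constant serves all steps.\<close>

lemma heat_powr_expansion:
  fixes c B p :: real
  assumes c: "0 < c" and p: "0 < p" "p \<le> 2"
  obtains C where "\<And>(F :: 'a::euclidean_space \<Rightarrow> real) G h x. \<lbrakk>gradient_pair c B F G; 0 \<le> h; h \<le> 1\<rbrakk> \<Longrightarrow>
    \<bar>heat h (\<lambda>y. F y powr p) x - heat h F x powr p
      - h / 2 * (p * (p - 1) * heat h F x powr (p - 2)) * (norm (heat h G x))\<^sup>2\<bar> \<le> C * (h * sqrt h)"
proof -
  define T where "T = \<bar>p * (p - 1) * (p - 2)\<bar> * c powr (p - 3) + \<bar>p * (p - 1)\<bar> * c powr (p - 2)"
  have T: "\<bar>p * (p - 1) * (p - 2)\<bar> * c powr (p - 3) \<le> T" "\<bar>p * (p - 1)\<bar> * c powr (p - 2) \<le> T"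
    by (simp_all add: T_def)
  let ?M = "moment6 TYPE('a)"
  have "\<bar>heat h (\<lambda>y. F y powr p) x - heat h F x powr p
      - h / 2 * (p * (p - 1) * heat h F x powr (p - 2)) * (norm (heat h G x))\<^sup>2\<bar>
      \<le> T * (64 * B ^ 3 * ?M ^ 3 + 15 * B\<^sup>2 * ?M\<^sup>2) * ?M * (h * sqrt h)"
    if gp: "gradient_pair c B F G" and h: "0 \<le> h" "h \<le> 1"
    for F :: "'a \<Rightarrow> real" and G h x
  proof (rule gradient_pair.heat_compose_taylor[OF gp h, where \<phi> = "\<lambda>u. u powr p"
          and \<phi>' = "\<lambda>u. p * u powr (p - 1)" and \<phi>'' = "\<lambda>u. p * (p - 1) * u powr (p - 2)"
          and K = "B powr p"])
      show "T \<ge> 0" by (simp add: T_def)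
      show "\<bar>u powr p\<bar> \<le> B powr p" if "c \<le> u" "u \<le> B" for u
        using that c p by (simp add: powr_mono2)
      show "\<bar>p * (p - 1) * u powr (p - 2)\<bar> \<le> T" if "c \<le> u" "u \<le> B" for u
      proof -
        have "u powr (p - 2) \<le> c powr (p - 2)" using that c p by (intro powr_mono2') auto
        then have "\<bar>p * (p - 1)\<bar> * u powr (p - 2) \<le> \<bar>p * (p - 1)\<bar> * c powr (p - 2)"
          by (intro mult_left_mono) auto
        then show ?thesis using T(2) by (simp add: abs_mult)
      qed
      show "\<bar>u powr p - v powr p - p * v powr (p - 1) * (u - v) - p * (p - 1) * v powr (p - 2) / 2 * (u - v)\<^sup>2\<bar>
        \<le> T * \<bar>u - v\<bar> ^ 3" if "c \<le> u" "u \<le> B" "c \<le> v" "v \<le> B" for u v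
        using powr_taylor[OF c that(1,3), of p] p
          mult_right_mono[OF T(1), of "\<bar>u - v\<bar> ^ 3"] by simp
  qed simp
  then show thesis by (rule that)
qed

context gradient_pair
begin

lemma integrable_F_powr:
  assumes "c > 0" "p \<ge> 0"
  shows "integrable gauss (\<lambda>z. F (x + a *\<^sub>R z) powr p)"
proof (rule integrable_gauss_bounded)
  show "norm (F y powr p) \<le> B powr p" for y
    using assms F_lower[of y] F_upper[of y] by (simp add: powr_mono2)
qed measurable

lemma powr_norm_le:
  assumes "c > 0" "p \<le> 0"
  shows "F y powr p * norm (G y) ^ k \<le> c powr p * B ^ k"
  using assms F_lower G_bound by (intro mult_mono powr_mono2' power_mono) auto

lemma integrable_F_powr_norm:
  assumes "c > 0" "p \<le> 0"
  shows "integrable gauss (\<lambda>z. F (x + a *\<^sub>R z) powr p * norm (G (x + a *\<^sub>R z)) ^ k)"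
  by (rule integrable_gauss_bounded[where K = "c powr p * B ^ k"])
    (auto intro: powr_norm_le assms)

text \<open>The pointwise bound is taken at the averaged value and gradient, then averaged. The mean
  of the power 2/3 is kept as it is: its deficit of about h y below the power of the mean is the
  second-order gain.\<close>

lemma heat_norm_sq_over_powr_ge:
  assumes c: "c > 0"
  shows "2 * heat h F x powr (-2/3) * (norm (heat h G x))\<^sup>2
      - (norm (heat h G x))\<^sup>2 * heat h F x powr (-4/3) * heat h (\<lambda>y. F y powr (2/3)) x
    \<le> heat h (\<lambda>y. F y powr (-2/3) * (norm (G y))\<^sup>2) x"
proof -
  define y where "y = heat h F x"
  define w where "w = heat h G x"
  have y: "y > 0" using heat_F_lower[of h x] c by (simp add: y_def)
  have Fpos: "F u > 0" for u using F_lower[of u] c by linarith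
  let ?X = "\<lambda>z. F (x + sqrt h *\<^sub>R z)" and ?V = "\<lambda>z. G (x + sqrt h *\<^sub>R z)"
  have "(\<integral>z. 2 * y powr (-2/3) * (w \<bullet> ?V z) - (norm w)\<^sup>2 * y powr (-4/3) * ?X z powr (2/3) \<partial>gauss)
      \<le> (\<integral>z. ?X z powr (-2/3) * (norm (?V z))\<^sup>2 \<partial>gauss)"
    using integrable_F_powr[OF c, of "2/3" x] integrable_F_powr_norm[OF c, of "-2/3" x]
      integrable_G[of x] norm_sq_over_powr_tangent[OF Fpos y]
    by (intro integral_mono) auto
  also have "(\<integral>z. 2 * y powr (-2/3) * (w \<bullet> ?V z) - (norm w)\<^sup>2 * y powr (-4/3) * ?X z powr (2/3) \<partial>gauss)
      = 2 * y powr (-2/3) * (w \<bullet> w) - (norm w)\<^sup>2 * y powr (-4/3) * heat h (\<lambda>y. F y powr (2/3)) x"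
    using integrable_F_powr[OF c, of "2/3" x] integrable_G[of x] by (simp add: heat_def w_def)
  finally show ?thesis
    by (simp add: heat_def power2_norm_eq_inner y_def w_def)
qed

text \<open>Jensen's inequality: for the tangent plane at the averages, both linear terms integrate
  to zero.\<close>

lemma heat_norm_quartic_over_powr_ge:
  assumes c: "c > 0"
  shows "(norm (heat h G x)) ^ 4 * heat h F x powr (-8/3)
    \<le> heat h (\<lambda>y. (norm (G y)) ^ 4 * F y powr (-8/3)) x"
proof -
  define y where "y = heat h F x"
  define w where "w = heat h G x"
  have y: "y > 0" using heat_F_lower[of h x] c by (simp add: y_def)
  have Fpos: "F u > 0" for u using F_lower[of u] c by linarith
  let ?X = "\<lambda>z. F (x + sqrt h *\<^sub>R z)" and ?V = "\<lambda>z. G (x + sqrt h *\<^sub>R z)"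
  have "(\<integral>z. (norm w) ^ 4 * y powr (-8/3) + 4 * (norm w)\<^sup>2 * y powr (-8/3) * (w \<bullet> ?V z - (norm w)\<^sup>2)
      - 8/3 * (norm w) ^ 4 * y powr (-8/3) / y * (?X z - y) \<partial>gauss)
      \<le> (\<integral>z. (norm (?V z)) ^ 4 * ?X z powr (-8/3) \<partial>gauss)"
    using integrable_F_powr_norm[OF c, of "-8/3" x "sqrt h" 4]
      integrable_F[of x] integrable_G[of x] norm_quartic_over_powr_tangent[OF Fpos y]
    by (intro integral_mono) (auto simp: mult.commute)
  also have "(\<integral>z. (norm w) ^ 4 * y powr (-8/3) + 4 * (norm w)\<^sup>2 * y powr (-8/3) * (w \<bullet> ?V z - (norm w)\<^sup>2)
      - 8/3 * (norm w) ^ 4 * y powr (-8/3) / y * (?X z - y) \<partial>gauss)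
      = (norm w) ^ 4 * y powr (-8/3) + 4 * (norm w)\<^sup>2 * y powr (-8/3) * (w \<bullet> w - (norm w)\<^sup>2)
      - 8/3 * (norm w) ^ 4 * y powr (-8/3) / y * (y - y)"
    using integrable_F[of x] integrable_G[of x]
    by (simp add: heat_def[symmetric] w_def[symmetric] y_def[symmetric])
  finally show ?thesis
    by (simp add: heat_def power2_norm_eq_inner y_def w_def)
qed

text \<open>A bound free of \<open>t\<close> and \<open>x\<close>, which the semigroup law and the
  monotonicity of \<open>heat\<close> require at every time.\<close>

lemma bellman_bound:
  assumes c: "c > 0" and t: "0 \<le> t" "t \<le> 1"
  shows "\<bar>bellman L t (F x) (G x)\<bar>
    \<le> B powr (4/3) + 2 * \<bar>L\<bar> * B powr (2/3) + c powr (-2/3) * B\<^sup>2 + B ^ 4 * c powr (-8/3) + L\<^sup>2"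
proof -
  have Fpos: "F u > 0" for u using F_lower[of u] c by linarith
  have "F x powr (4/3) \<le> B powr (4/3)" "F x powr (2/3) \<le> B powr (2/3)"
    using Fpos[of x] F_upper[of x] by (simp_all add: powr_mono2)
  moreover have "F x powr (-2/3) * (norm (G x))\<^sup>2 \<le> c powr (-2/3) * B\<^sup>2"
    using powr_norm_le[OF c] by simp
  moreover have "(norm (G x)) ^ 4 * F x powr (-8/3) \<le> B ^ 4 * c powr (-8/3)"
    using powr_norm_le[OF c, of "-8/3" x 4] by (simp add: mult.commute)
  moreover have t4: "\<bar>t * (1 - t) / 81\<bar> \<le> 1"
    using t mult_mono[of t 1 "1 - t" 1] by simp
  moreover have aux: "\<bar>a * u\<bar> \<le> U" if "\<bar>a\<bar> \<le> 1" "0 \<le> u" "u \<le> U" for a u U :: real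
    using that mult_mono[of "\<bar>a\<bar>" 1 u U] by (simp add: abs_mult)
  ultimately have "\<bar>2/9 * t * (F x powr (-2/3) * (norm (G x))\<^sup>2)\<bar> \<le> c powr (-2/3) * B\<^sup>2"
    "\<bar>t * (1 - t) / 81 * ((norm (G x)) ^ 4 * F x powr (-8/3))\<bar> \<le> B ^ 4 * c powr (-8/3)"
    using t aux[of "2/9 * t" "F x powr (-2/3) * (norm (G x))\<^sup>2"]
      aux[of "t * (1 - t) / 81" "(norm (G x)) ^ 4 * F x powr (-8/3)"]
    by auto
  moreover have "\<bar>2 * L * F x powr (2/3)\<bar> \<le> 2 * \<bar>L\<bar> * B powr (2/3)"
    using \<open>F x powr (2/3) \<le> B powr (2/3)\<close> by (simp add: abs_mult mult_left_mono)
  moreover have "\<bar>L\<^sup>2 * t\<bar> \<le> L\<^sup>2" "\<bar>F x powr (4/3)\<bar> \<le> B powr (4/3)"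
    using t \<open>F x powr (4/3) \<le> B powr (4/3)\<close> by (simp_all add: mult_left_le)
  ultimately show ?thesis unfolding bellman_def by linarith
qed

end

lemma heat_bellman_le:
  fixes c B L :: real
  assumes c: "0 < c"
  obtains C where "\<And>(F :: 'a::euclidean_space \<Rightarrow> real) G t h x. \<lbrakk>gradient_pair c B F G; 0 \<le> t; 0 \<le> h; t + h \<le> 1\<rbrakk> \<Longrightarrow>
    heat h (\<lambda>y. bellman L (t + h) (F y) (G y)) x
      \<le> bellman L t (heat h F x) (heat h G x) + C * (h * sqrt h)"
proof -
  obtain C1 where C1: "\<And>(F :: 'a \<Rightarrow> real) G h x. \<lbrakk>gradient_pair c B F G; 0 \<le> h; h \<le> 1\<rbrakk> \<Longrightarrow>
    \<bar>heat h (\<lambda>y. F y powr (4/3)) x - heat h F x powr (4/3)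
      - h / 2 * (4/3 * (4/3 - 1) * heat h F x powr (4/3 - 2)) * (norm (heat h G x))\<^sup>2\<bar> \<le> C1 * (h * sqrt h)"
    by (rule heat_powr_expansion[OF c, where 'a = 'a and B = B and p = "4/3"]) (simp, simp, rule that)
  obtain C2 where C2: "\<And>(F :: 'a \<Rightarrow> real) G h x. \<lbrakk>gradient_pair c B F G; 0 \<le> h; h \<le> 1\<rbrakk> \<Longrightarrow>
    \<bar>heat h (\<lambda>y. F y powr (2/3)) x - heat h F x powr (2/3)
      - h / 2 * (2/3 * (2/3 - 1) * heat h F x powr (2/3 - 2)) * (norm (heat h G x))\<^sup>2\<bar> \<le> C2 * (h * sqrt h)"
    by (rule heat_powr_expansion[OF c, where 'a = 'a and B = B and p = "2/3"]) (simp, simp, rule that)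
  define m where "m = B\<^sup>2 * c powr (-4/3)"
  have "heat h (\<lambda>y. bellman L (t + h) (F y) (G y)) x
      \<le> bellman L t (heat h F x) (heat h G x) + (C1 + 2 * (\<bar>L\<bar> + m) * C2) * (h * sqrt h)"
    if gp: "gradient_pair c B F G" and th: "0 \<le> t" "0 \<le> h" "t + h \<le> 1"
    for F :: "'a \<Rightarrow> real" and G t h x
  proof -
    interpret gradient_pair c B F G by fact
    have h: "h \<le> 1" using th by simp
    define b v where "b = heat h F x" and "v = heat h G x"
    \<comment> \<open>The rate at which the power 2/3 decreases: half of its second-derivative
      factor 2/3 * 1/3 gives 1/9.\<close>
    define y where "y = (norm v)\<^sup>2 * b powr (-4/3) / 9"
    define k where "k = b powr (-2/3) * (norm v)\<^sup>2"
    have b: "b \<ge> c" "b > 0" using heat_F_lower[of h x] c by (simp_all add: b_def)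
    have vB: "norm v \<le> B" unfolding v_def by (rule norm_heat_le) (auto intro: G_bound)
    have powrs: "b powr (-4/3) * b powr (2/3) = b powr (-2/3)" "(b powr (-4/3))\<^sup>2 = b powr (-8/3)"
      using b by (simp_all add: powr_power flip: powr_add)
    have Y: "81 * y\<^sup>2 = (norm v) ^ 4 * b powr (-8/3)"
      unfolding y_def powrs(2)[symmetric] by (simp add: power_divide power_mult_distrib flip: power_mult)
    let ?a1 = "heat h (\<lambda>y. F y powr (4/3)) x" and ?a2 = "heat h (\<lambda>y. F y powr (2/3)) x"
      and ?K = "heat h (\<lambda>y. F y powr (-2/3) * (norm (G y))\<^sup>2) x"
      and ?Y = "heat h (\<lambda>y. (norm (G y)) ^ 4 * F y powr (-8/3)) x"
    have "heat h (\<lambda>y. bellman L (t + h) (F y) (G y)) x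
      = ?a1 - 2 * L * ?a2 - 2/9 * (t + h) * ?K - (t + h) * (1 - (t + h)) / 81 * ?Y - L\<^sup>2 * (t + h)"
      unfolding heat_def bellman_def
      using integrable_F_powr[OF c, of _ x] integrable_F_powr_norm[OF c, of "-2/3" x _ 2]
        integrable_F_powr_norm[OF c, of "-8/3" x _ 4] by (simp add: mult.commute[of _ "_ powr _"])
    also have "\<dots> \<le> b powr (4/3) - 2 * L * b powr (2/3) - 2/9 * t * k - t * (1 - t) / 81 * (81 * y\<^sup>2) - L\<^sup>2 * t
      + (C1 + 2 * (\<bar>L\<bar> + m) * C2) * (h * sqrt h)"
    proof (rule bellman_step_aux)
      show "?a1 - b powr (4/3) - 2/9 * h * k \<le> C1 * (h * sqrt h)"
        using C1[OF gp th(2) h, of x] by (simp add: k_def b_def v_def mult_ac)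
      show "\<bar>b powr (2/3) - ?a2 - h * y\<bar> \<le> C2 * (h * sqrt h)"
        using C2[OF gp th(2) h, of x] by (simp add: y_def b_def v_def mult_ac)
      have "k + 9 * y * (b powr (2/3) - ?a2)
          = 2 * b powr (-2/3) * (norm v)\<^sup>2 - (norm v)\<^sup>2 * b powr (-4/3) * ?a2"
        unfolding k_def y_def powrs(1)[symmetric] by (simp add: algebra_simps)
      also have "\<dots> \<le> ?K" unfolding b_def v_def by (rule heat_norm_sq_over_powr_ge[OF c])
      finally show "k + 9 * y * (b powr (2/3) - ?a2) \<le> ?K" .
      show "81 * y\<^sup>2 \<le> ?Y"
        unfolding Y unfolding b_def v_def by (rule heat_norm_quartic_over_powr_ge[OF c])
      show "0 \<le> y" by (simp add: y_def)
      have "(norm v)\<^sup>2 * b powr (-4/3) \<le> m"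
        unfolding m_def using b c vB by (intro mult_mono power_mono powr_mono2') auto
      moreover have "0 \<le> (norm v)\<^sup>2 * b powr (-4/3)" by simp
      ultimately show "y \<le> m" unfolding y_def by linarith
    qed (use th in auto)
    finally show ?thesis
      unfolding bellman_def Y k_def b_def v_def .
  qed
  then show thesis by (rule that)
qed

section \<open>From one step to the whole time interval\<close>

lemma heat_mono:
  fixes U V :: "'a::euclidean_space \<Rightarrow> real"
  assumes "U \<in> borel_measurable borel" "V \<in> borel_measurable borel"
    and "\<And>x. \<bar>U x\<bar> \<le> K" "\<And>x. \<bar>V x\<bar> \<le> K" "\<And>x. U x \<le> V x + e"
  shows "heat r U x \<le> heat r V x + e"
proof -
  have [measurable]: "U \<in> borel_measurable borel" "V \<in> borel_measurable borel" by fact+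
  have i: "integrable gauss (\<lambda>z. U (x + sqrt r *\<^sub>R z))" "integrable gauss (\<lambda>z. V (x + sqrt r *\<^sub>R z))"
    using assms(3,4) by (intro integrable_gauss_bounded[where K = K]; simp)+
  have "heat r U x \<le> (\<integral>z. V (x + sqrt r *\<^sub>R z) + e \<partial>gauss)"
    unfolding heat_def using i assms(5) by (intro integral_mono) auto
  also have "\<dots> = heat r V x + e"
    unfolding heat_def using i by simp
  finally show ?thesis .
qed

lemma (in gradient_pair) heat_bellman_global:
  assumes c: "c > 0"
  shows "heat 1 (\<lambda>y. bellman L 1 (F y) (G y)) x \<le> bellman L 0 (heat 1 F x) (heat 1 G x)"
proof -
  obtain C where step: "\<And>(F :: 'a \<Rightarrow> real) G t h x. \<lbrakk>gradient_pair c B F G; 0 \<le> t; 0 \<le> h; t + h \<le> 1\<rbrakk> \<Longrightarrow>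
    heat h (\<lambda>y. bellman L (t + h) (F y) (G y)) x
      \<le> bellman L t (heat h F x) (heat h G x) + C * (h * sqrt h)"
    by (rule heat_bellman_le[OF c, where 'a = 'a and B = B and L = L]) (rule that)
  define K where "K = B powr (4/3) + 2 * \<bar>L\<bar> * B powr (2/3) + c powr (-2/3) * B\<^sup>2 + B ^ 4 * c powr (-8/3) + L\<^sup>2"
  \<comment> \<open>\<open>heat t (W t) x\<close> is the expectation of
    \<open>S t (M t) (N t)\<close> when the Brownian motion starts in \<open>x\<close>.\<close>
  define W where "W t y = bellman L t (heat (1 - t) F y) (heat (1 - t) G y)" for t y
  have W_meas [measurable]: "W t \<in> borel_measurable borel" for t unfolding W_def by measurable
  have W_bound: "\<bar>W t y\<bar> \<le> K" if "0 \<le> t" "t \<le> 1" for t y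
    unfolding W_def K_def by (rule gradient_pair.bellman_bound[OF gradient_pair_heat c that])
  have bound: "heat 1 (W 1) x \<le> heat 0 (W 0) x + C * sqrt (1 / real (Suc n))" for n
  proof -
    define h where "h = 1 / real (Suc n)"
    have h: "h > 0" by (simp add: h_def)
    have one: "heat (t + h) (W (t + h)) x \<le> heat t (W t) x + C * (h * sqrt h)"
      if t: "0 \<le> t" "t + h \<le> 1" for t
    proof -
      have "heat (t + h) (W (t + h)) x = heat t (heat h (W (t + h))) x"
        using W_bound[of "t + h"] t h by (subst heat_heat[where K = K]) auto
      also have "\<dots> \<le> heat t (W t) x + C * (h * sqrt h)"
      proof (rule heat_mono[where K = K])
        show "heat h (W (t + h)) \<in> borel_measurable borel" "W t \<in> borel_measurable borel"
          by measurable
        show "\<bar>heat h (W (t + h)) y\<bar> \<le> K" for y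
          using norm_heat_le[of "W (t + h)" K h y] W_bound[of "t + h"] t h by simp
        show "\<bar>W t y\<bar> \<le> K" for y using W_bound t h by simp
        fix y
        \<comment> \<open>The martingale property: value and gradient at time t are averages of
          those at time t + h.\<close>
        have "heat h (heat (1 - (t + h)) F) y = heat (1 - t) F y"
          "heat h (heat (1 - (t + h)) G) y = heat (1 - t) G y"
          using t h heat_heat[OF F_measurable abs_F_le, of h "1 - (t + h)" y]
            heat_heat[OF G_measurable G_bound, of h "1 - (t + h)" y] by simp_all
        then show "heat h (W (t + h)) y \<le> W t y + C * (h * sqrt h)"
          using step[OF gradient_pair_heat[of "1 - (t + h)"] t(1) _ t(2), of y] h
          by (simp add: W_def[abs_def])
      qed
      finally show ?thesis .
    qed
    have "heat (real k * h) (W (real k * h)) x \<le> heat 0 (W 0) x + real k * (C * (h * sqrt h))"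
      if "k \<le> Suc n" for k
      using that
    proof (induction k)
      case (Suc k)
      have "real (Suc k) * h \<le> 1"
        using Suc.prems by (simp add: h_def divide_simps)
      then have "heat (real k * h + h) (W (real k * h + h)) x \<le> heat (real k * h) (W (real k * h)) x + C * (h * sqrt h)"
        using h by (intro one) (auto simp: algebra_simps)
      with Suc show ?case by (simp add: algebra_simps)
    qed simp
    from this[of "Suc n"] have "heat 1 (W 1) x \<le> heat 0 (W 0) x + real (Suc n) * (C * (h * sqrt h))"
      by (simp add: h_def)
    also have "real (Suc n) * (C * (h * sqrt h)) = C * sqrt h"
      by (simp add: h_def)
    finally show ?thesis by (simp add: h_def)
  qed
  have "(\<lambda>n. heat 0 (W 0) x + C * sqrt (1 / real (Suc n))) \<longlonglongrightarrow> heat 0 (W 0) x + C * 0"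
    by (intro tendsto_intros) real_asymp
  then have "heat 1 (W 1) x \<le> heat 0 (W 0) x"
    using bound by (intro LIMSEQ_le_const) auto
  then show ?thesis by (simp add: W_def[abs_def])
qed

subsection \<open>Gradients of smooth bounded functions\<close>

lemma norm_grad_le:
  fixes w :: "'a::euclidean_space \<Rightarrow> real"
  assumes "\<And>e. e \<in> Basis \<Longrightarrow> \<bar>partial_deriv e w x\<bar> \<le> K"
  shows "norm (grad w x) \<le> real DIM('a) * K"
proof -
  have "norm (grad w x) \<le> (\<Sum>e::'a\<in>Basis. K)"
    unfolding grad_def using assms by (intro sum_norm_le) simp
  then show ?thesis by simp
qed

lemma has_derivative_grad:
  assumes "w differentiable (at x)"
  shows "(w has_derivative (\<lambda>h. h \<bullet> grad w x)) (at x)"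
  using GDERIV_grad[OF assms] by (simp add: gderiv_def)

lemma onorm_inner_le: "onorm (\<lambda>h. h \<bullet> a) \<le> norm a"
  by (rule onorm_bound) (simp_all add: Cauchy_Schwarz_ineq2 mult.commute[of "norm a"])

lemma grad_bounded_lipschitz:
  fixes w :: "'a::euclidean_space \<Rightarrow> real"
  assumes "\<And>x. w differentiable (at x)" and "\<And>x. norm (grad w x) \<le> K"
  shows "\<bar>w (x + u) - w x\<bar> \<le> K * norm u"
  using differentiable_bound[of UNIV w "\<lambda>y h. h \<bullet> grad w y" K "x + u" x] assms
  by (auto intro: has_derivative_grad order_trans[OF onorm_inner_le])

text \<open>Mean value inequality for \<open>w\<close> minus its linearisation at \<open>x\<close>:
  on the ball of radius |u| the derivative of the difference is at most K |u|. The loss of a factor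
  1/2 is harmless.\<close>

lemma grad_lipschitz_taylor:
  fixes w :: "'a::euclidean_space \<Rightarrow> real"
  assumes d: "\<And>x. w differentiable (at x)" and K: "K \<ge> 0"
    and lip: "\<And>x u. norm (grad w (x + u) - grad w x) \<le> K * norm u"
  shows "\<bar>w (x + u) - w x - grad w x \<bullet> u\<bar> \<le> K * (norm u)\<^sup>2"
proof -
  let ?h = "\<lambda>y. w (x + y) - y \<bullet> grad w x"
  have "norm (?h u - ?h 0) \<le> (K * norm u) * norm (u - 0)"
  proof (rule differentiable_bound[of "cball 0 (norm u)" ?h "\<lambda>y k. k \<bullet> (grad w (x + y) - grad w x)"])
    fix y :: 'a assume y: "y \<in> cball 0 (norm u)"
    have "((\<lambda>y. w (x + y)) has_derivative (\<lambda>k. k \<bullet> grad w (x + y))) (at y)"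
    proof (rule has_derivative_compose[where f = "\<lambda>y. x + y" and f' = "\<lambda>k. k"])
      show "((\<lambda>y. x + y) has_derivative (\<lambda>k. k)) (at y)"
        by (auto intro!: derivative_eq_intros)
    qed (rule has_derivative_grad[OF d])
    then have "(?h has_derivative (\<lambda>k. k \<bullet> grad w (x + y) - k \<bullet> grad w x)) (at y)"
      by (auto intro!: derivative_eq_intros)
    then show "(?h has_derivative (\<lambda>k. k \<bullet> (grad w (x + y) - grad w x))) (at y within cball 0 (norm u))"
      by (simp add: inner_diff_right has_derivative_at_withinI)
    show "onorm (\<lambda>k. k \<bullet> (grad w (x + y) - grad w x)) \<le> K * norm u"
      using onorm_inner_le[of "grad w (x + y) - grad w x"] lip[of x y] mult_left_mono[OF _ K, of "norm y" "norm u"] y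
      by simp
  qed auto
  then show ?thesis by (simp add: inner_commute power2_eq_square mult.assoc algebra_simps)
qed

lemma partial_deriv_add_const:
  fixes w :: "'a::euclidean_space \<Rightarrow> real"
  assumes "\<And>x. w differentiable (at x)"
  shows "partial_deriv e (\<lambda>x. w x + k) = partial_deriv e w"
proof
  fix x
  have "(w has_derivative frechet_derivative w (at x)) (at x)"
    using assms by (simp add: frechet_derivative_works)
  then have "((\<lambda>x. w x + k) has_derivative frechet_derivative w (at x)) (at x)"
    by (auto intro!: derivative_eq_intros)
  then show "partial_deriv e (\<lambda>x. w x + k) x = partial_deriv e w x"
    unfolding partial_deriv_def by (simp flip: frechet_derivative_at)
qed

lemma Cb_infinity_D:
  fixes g :: "'a::euclidean_space \<Rightarrow> real"
  assumes "g \<in> Cb_infinity" "set es \<subseteq> Basis"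
  shows "iter_partial_deriv es g differentiable (at x)" "bounded (range (iter_partial_deriv es g))"
  using assms by (auto simp: Cb_infinity_def)

text \<open>Partial derivatives up to order two suffice: the first bound the gradient, the second
  make it Lipschitz, which also gives the Taylor bound. The added positive constant becomes the
  lower bound \<open>c\<close>.\<close>

lemma gradient_pair_Cb_infinity_const_pos:
  fixes f :: "'a::euclidean_space \<Rightarrow> real"
  assumes "f \<in> Cb_infinity_const_pos"
  obtains c B where "c > 0" "gradient_pair c B f (grad f)"
proof -
  from assms obtain g c where g: "g \<in> Cb_infinity" "\<And>x. 0 \<le> g x" and c: "c > 0" and f: "f = (\<lambda>x. g x + c)"
    by (auto simp: Cb_infinity_const_pos_def)
  have gd: "g differentiable (at x)" for x using Cb_infinity_D(1)[OF g(1), of "[]"] by simp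
  have fd: "f differentiable (at x)" for x unfolding f using gd by (intro differentiable_add) auto
  have pd: "partial_deriv e f = partial_deriv e g" for e
    unfolding f using gd by (rule partial_deriv_add_const)
  have pdd: "partial_deriv e f differentiable (at x)" if "e \<in> Basis" for e x
    using Cb_infinity_D(1)[OF g(1), of "[e]"] that by (simp add: pd)
  have "bounded (range g)" using Cb_infinity_D(2)[OF g(1), of "[]"] by simp
  then obtain K0 where K0: "\<And>x. \<bar>g x\<bar> \<le> K0" by (auto simp: bounded_iff)
  have "bounded (\<Union>e\<in>Basis. range (partial_deriv e g))"
    using Cb_infinity_D(2)[OF g(1), of "[_]"] by (intro bounded_UN) auto
  then obtain K1 where "\<forall>e\<in>Basis. \<forall>x. \<bar>partial_deriv e g x\<bar> \<le> K1"
    unfolding bounded_iff by fastforce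
  then have K1: "\<bar>partial_deriv e f x\<bar> \<le> K1" if "e \<in> Basis" for e x
    using that by (simp add: pd)
  have "bounded (\<Union>p\<in>Basis \<times> Basis. range (partial_deriv (fst p) (partial_deriv (snd p) g)))"
    using Cb_infinity_D(2)[OF g(1), of "[_, _]"] by (intro bounded_UN) auto
  then obtain K2 where "\<forall>e\<in>Basis. \<forall>e'\<in>Basis. \<forall>x. \<bar>partial_deriv e' (partial_deriv e g) x\<bar> \<le> K2"
    unfolding bounded_iff by fastforce
  then have K2: "\<bar>partial_deriv e' (partial_deriv e f) x\<bar> \<le> K2" if "e \<in> Basis" "e' \<in> Basis" for e e' x
    using that by (simp add: pd)
  define n where "n = real DIM('a)"
  have n: "n \<ge> 0" by (simp add: n_def)
  have K1': "norm (grad f x) \<le> n * \<bar>K1\<bar>" for x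
    unfolding n_def by (intro norm_grad_le order_trans[OF K1 abs_ge_self])
  have lip1: "\<bar>partial_deriv e f (x + u) - partial_deriv e f x\<bar> \<le> n * \<bar>K2\<bar> * norm u" if "e \<in> Basis" for e x u
    using that unfolding n_def
    by (intro grad_bounded_lipschitz pdd norm_grad_le) (auto intro: order_trans[OF K2 abs_ge_self])
  have lip: "norm (grad f (x + u) - grad f x) \<le> n * (n * \<bar>K2\<bar>) * norm u" for x u
  proof -
    have "grad f (x + u) - grad f x = (\<Sum>e\<in>Basis. (partial_deriv e f (x + u) - partial_deriv e f x) *\<^sub>R e)"
      by (simp add: grad_def sum_subtractf scaleR_diff_left)
    also have "norm \<dots> \<le> (\<Sum>e::'a\<in>Basis. n * \<bar>K2\<bar> * norm u)"
      using lip1 by (intro sum_norm_le) simp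
    finally show ?thesis by (simp add: n_def)
  qed
  define B where "B = \<bar>K0\<bar> + c + n * \<bar>K1\<bar> + n * (n * \<bar>K2\<bar>)"
  have B: "K0 + c \<le> B" "n * \<bar>K1\<bar> \<le> B" "n * (n * \<bar>K2\<bar>) \<le> B" "B \<ge> 0"
  proof -
    have "0 \<le> n * \<bar>K1\<bar>" "0 \<le> n * (n * \<bar>K2\<bar>)" using n by simp_all
    then show "K0 + c \<le> B" "n * \<bar>K1\<bar> \<le> B" "n * (n * \<bar>K2\<bar>) \<le> B" "B \<ge> 0"
      using c unfolding B_def by linarith+
  qed
  have lipB: "norm (grad f (x + u) - grad f x) \<le> B * norm u" for x u
    using lip[of x u] mult_right_mono[OF B(3), of "norm u"] by simp
  have "gradient_pair c B f (grad f)"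
  proof
    show "f \<in> borel_measurable borel"
      using fd by (intro borel_measurable_continuous_onI)
        (simp add: continuous_on_eq_continuous_at differentiable_imp_continuous_within)
    have "partial_deriv e f \<in> borel_measurable borel" if "e \<in> Basis" for e
      using pdd[OF that] by (intro borel_measurable_continuous_onI)
        (simp add: continuous_on_eq_continuous_at differentiable_imp_continuous_within)
    then show "grad f \<in> borel_measurable borel"
      unfolding grad_def[abs_def] by (intro borel_measurable_sum borel_measurable_scaleR) auto
    show "c \<le> f x" "f x \<le> B" for x
      using g(2)[of x] K0[of x] B(1) by (auto simp: f)
    show "norm (grad f x) \<le> B" for x using K1'[of x] B(2) by linarith
    show "norm (grad f (x + u) - grad f x) \<le> B * norm u" for x u by (rule lipB)
    show "\<bar>f (x + u) - f x - grad f x \<bullet> u\<bar> \<le> B * (norm u)\<^sup>2" for x u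
      by (rule grad_lipschitz_taylor[OF fd B(4) lipB])
  qed
  with c show thesis by (rule that)
qed

section \<open>Conclusion\<close>

lemma gauss_norm_powr:
  assumes "p \<noteq> 0"
  shows "gauss_norm p f powr p = (\<integral>x. \<bar>f x\<bar> powr p \<partial>gauss)"
  using assms by (simp add: gauss_norm_def powr_powr integral_nonneg_AE)

lemma gauss_norm_1: "gauss_norm 1 f = (\<integral>x. \<bar>f x\<bar> \<partial>gauss)"
  by (simp add: gauss_norm_def)

theorem proposition3p1:
  fixes f :: "real ^ 'd \<Rightarrow> real"
  assumes "f \<in> Cb_infinity_const_pos"
  shows "I_fun (4/3) f + 1/3 * (I_fun (2/3) f)\<^sup>2
         \<le> 2/3 * gauss_norm 1 (\<lambda>x. f x powr (-2/3) * (norm (grad f x))\<^sup>2)"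
proof -
  obtain c B where c: "c > 0" and gp: "gradient_pair c B f (grad f)"
    using gradient_pair_Cb_infinity_const_pos[OF assms] by blast
  interpret gradient_pair c B f "grad f" by (rule gp)
  have fpos: "f x > 0" for x using F_lower[of x] c by linarith
  define m where "m = (\<integral>x. f x \<partial>gauss)"
  define a where "a = (\<integral>x. f x powr (2/3) \<partial>gauss)"
  define b where "b = (\<integral>x. f x powr (4/3) \<partial>gauss)"
  define J where "J = (\<integral>x. f x powr (-2/3) * (norm (grad f x))\<^sup>2 \<partial>gauss)"
  define L where "L = m powr (2/3) - a"
  \<comment> \<open>At time 1 and starting point 0, \<open>heat\<close> is integration against
    \<open>gauss\<close>.\<close>
  have "heat 1 (\<lambda>y. bellman L 1 (f y) (grad f y)) 0 = b - 2 * L * a - 2/9 * J - L\<^sup>2"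
    unfolding heat_def bellman_def b_def a_def J_def
    using integrable_F_powr[OF c, of _ 0 1] integrable_F_powr_norm[OF c, of "-2/3" 0 1 2] by simp
  moreover have "bellman L 0 (heat 1 f 0) (heat 1 (grad f) 0) = m powr (4/3) - 2 * L * m powr (2/3)"
    by (simp add: bellman_def heat_def m_def)
  ultimately have "b - 2 * L * a - 2/9 * J - L\<^sup>2 \<le> m powr (4/3) - 2 * L * m powr (2/3)"
    using heat_bellman_global[OF c, of L 0] by simp
  then have main: "b - m powr (4/3) + L\<^sup>2 \<le> 2/9 * J"
    by (simp add: L_def power2_eq_square algebra_simps)
  have "gauss_norm 1 f = m"
    using fpos by (simp add: gauss_norm_1 m_def abs_of_pos)
  \<comment> \<open>The factors 1 / (p - 1) are 3 and -3, and \<open>L\<close> is defined with the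
    sign that absorbs the second, so the claim is three times \<open>main\<close>.\<close>
  then have "I_fun (4/3) f = 3 * (b - m powr (4/3))" "I_fun (2/3) f = 3 * L"
    using fpos by (simp_all add: I_fun_def gauss_norm_powr a_def b_def L_def abs_of_pos)
  moreover have "gauss_norm 1 (\<lambda>x. f x powr (-2/3) * (norm (grad f x))\<^sup>2) = J"
    by (simp add: gauss_norm_1 J_def)
  ultimately show ?thesis
    using main by (simp add: power_mult_distrib)
qed

end
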